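(* Let $K\subseteq\mathbb{R}^d$ be a convex body of volume one, and let $\mathcal F$ be a family of positive homothets of $K$ whose total volume is at least \[\begin{cases}(d^3\ln d\cdot\vartheta(K)+e)\,2^d, & \text{if } K=-K,\\[2pt] d^3\ln d\cdot\vartheta(K)\binom{2d}{d}+e\cdot 4^d, & \text{in general}.\end{cases}\] Then $\mathcal F$ permits a translative covering of $K$.
   Context: A convex body is a compact convex subset of $\mathbb{R}^d$ with nonempty interior; a positive homothet of $K$ is a set $\lambda K+x$ with $\lambda>0$, $x\in\mathbb{R}^d$. $\mathcal F$ permits a translative covering of $A$ if one can select a translation vector $x_F$ for each $F\in\mathcal F$ such that $A\subseteq\bigcup_{F\in\mathcal F}(x_F+F)$. $\vartheta(K)$ is the translative covering density of $K$: the infimum of the densities $\limsup_{r\to\infty}\frac{\sum_{i:\,C_i\subseteq rB}\operatorname{vol}(C_i)}{\operatorname{vol}(rB)}$ over all coverings $\{C_i\}$ of $\mathbb{R}^d$ by translates of $K$ ($B$ the Euclidean unit ball). *)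

theory Defs
  imports "HOL-Analysis.Analysis"
begin

definition convex_body :: "'a::euclidean_space set \<Rightarrow> bool" where
  "convex_body K \<longleftrightarrow> compact K \<and> convex K \<and> interior K \<noteq> {}"

definition positive_homothet :: "'a::euclidean_space set \<Rightarrow> 'a set \<Rightarrow> bool" where
  "positive_homothet K H \<longleftrightarrow> (\<exists>l x. l > 0 \<and> H = (\<lambda>y. x + y) ` ((\<lambda>y. l *\<^sub>R y) ` K))"

definition permits_translative_covering ::
  "'i set \<Rightarrow> ('i \<Rightarrow> 'a::euclidean_space set) \<Rightarrow> 'a set \<Rightarrow> bool" where
  "permits_translative_covering I F A \<longleftrightarrow>
     (\<exists>t :: 'i \<Rightarrow> 'a. A \<subseteq> (\<Union>i\<in>I. (\<lambda>y. t i + y) ` F i))"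

definition translative_covering_density :: "'a::euclidean_space set \<Rightarrow> ennreal" where
  "translative_covering_density K =
     (INF X \<in> {X :: 'a set. (\<Union>x\<in>X. (\<lambda>y. x + y) ` K) = UNIV}.
        Limsup at_top (\<lambda>r::real.
          (\<Sum>\<^sub>\<infinity> x \<in> {x\<in>X. (\<lambda>y. x + y) ` K \<subseteq> cball 0 r}. emeasure lebesgue ((\<lambda>y. x + y) ` K))
          / emeasure lebesgue (cball (0::'a) r)))"

end

theory Submission
  imports Defs "HOL-Real_Asymp.Real_Asymp"
begin

text \<open>
  If some homothet has ratio at least one, it covers \<open>K\<close> alone, so let all ratios be below one.

  In dimension \<open>d \<ge> 3\<close>, round the ratios down to powers of \<open>q = d / (d + 1)\<close>, which costs less than a
  factor \<open>e\<close> in volume, and keep the best residue class of exponents modulo \<open>d (d - 1)\<close>. Any two distinct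
  ratios left differ by a factor of at most \<open>\<epsilon> = q ^ (d (d - 1))\<close>. Go through them from large to small.
  At ratio \<open>r\<close>, the part still to be covered has an economical covering by translates of
  \<open>(1 - \<epsilon>) r K\<close>, with density close to \<open>\<vartheta>(K)\<close>; place the available homothets
  at its best members. A point missed by the full homothets has its whole neighbourhood at the next scale
  missed by the shrunk ones, so the volume of this neighbourhood of the uncovered set drops by a fixed
  proportion \<open>(1 - \<epsilon>)\<^sup>d / \<vartheta>(K)\<close> of the volume spent. Initially it is close to
  \<open>vol (K - K)\<close>, which is \<open>2\<^sup>d\<close> for symmetric \<open>K\<close> and at most \<open>2d choose d\<close> by Rogers and
  Shephard.

  In dimensions one and two, and when \<open>\<vartheta>(K)\<close> is infinite, \<open>K\<close> contains a parallelotope a bounded multiple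
  of which contains \<open>K\<close>, and dyadic subdivision of the larger one into copies of the smaller suffices
  (together with \<open>\<vartheta>(K) \<ge> 1\<close> in the plane).
\<close>

section \<open>Economical coverings of bounded windows\<close>

definition homothet :: "'a::real_vector \<Rightarrow> real \<Rightarrow> 'a set \<Rightarrow> 'a set" where
  "homothet t l K = (\<lambda>y. t + l *\<^sub>R y) ` K"

text \<open>The members may be translated freely, so a family of homothets enters only through its
  ratios \<open>r\<close>; the positions are existentially quantified.\<close>

definition covers_with :: "'i set \<Rightarrow> ('i \<Rightarrow> real) \<Rightarrow> 'a::real_vector set \<Rightarrow> 'a set \<Rightarrow> bool" where
  "covers_with J r K A \<longleftrightarrow> (\<exists>t. A \<subseteq> (\<Union>i\<in>J. homothet (t i) (r i) K))"

lemma emeasure_homothet: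
  fixes K :: "'a::euclidean_space set"
  assumes "l \<ge> 0"
  shows "emeasure lebesgue (homothet t l K) = ennreal (l ^ DIM('a)) * emeasure lebesgue K"
  using emeasure_lebesgue_affine[of l t K] assms
  by (simp add: homothet_def add.commute ennreal_power)

lemma measure_homothet:
  fixes K :: "'a::euclidean_space set"
  assumes "l \<ge> 0"
  shows "measure lebesgue (homothet t l K) = l ^ DIM('a) * measure lebesgue K"
  using measure_lebesgue_affine[of l t K] assms
  by (simp add: homothet_def add.commute)

lemma measure_cball_conv_unit:
  fixes r :: real
  assumes "r \<ge> 0"
  shows "measure lebesgue (cball (0::'a::euclidean_space) r) = r ^ DIM('a) * measure lebesgue (cball (0::'a) 1)"
proof -
  have "cball (0::'a) r = homothet 0 r (cball 0 1)"
    using assms cball_scale[of r "0::'a" 1] by (cases "r = 0") (auto simp: homothet_def image_constant_conv)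
  then show ?thesis
    using measure_homothet[OF assms, of "0::'a" "cball 0 1"] by simp
qed

text \<open>All translates have volume one, so the sum in the density counts those inside the ball.
  An infinite count would make the quotient infinite, against the finite bound
  \<open>\<theta>\<close>.\<close>

lemma eventually_card_le_density:
  fixes K :: "'a::euclidean_space set"
  assumes K1: "emeasure lebesgue K = 1"
    and lim: "Limsup at_top (\<lambda>r::real.
          (\<Sum>\<^sub>\<infinity> x \<in> {x\<in>X. (+) x ` K \<subseteq> cball 0 r}. emeasure lebesgue ((+) x ` K))
          / emeasure lebesgue (cball (0::'a) r)) < ennreal \<theta>"
  shows "\<forall>\<^sub>F r in at_top. finite {x\<in>X. (+) x ` K \<subseteq> cball 0 r} \<and>
     real (card {x\<in>X. (+) x ` K \<subseteq> cball 0 r}) \<le> \<theta> * measure lebesgue (cball (0::'a) r)"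
  using Limsup_lessD[OF lim] eventually_gt_at_top[of 0]
proof eventually_elim
  case (elim r)
  define S where "S = {x\<in>X. (+) x ` K \<subseteq> cball 0 r}"
  define c where "c = measure lebesgue (cball (0::'a) r)"
  have c: "c > 0" using content_cball_pos[of r 0] elim by (simp add: c_def)
  have ce: "emeasure lebesgue (cball (0::'a) r) = ennreal c"
    unfolding c_def by (rule emeasure_eq_ennreal_measure) (use emeasure_lborel_cball_finite[of "0::'a" r] in auto)
  have m1: "emeasure lebesgue ((+) x ` K) = 1" for x
    using emeasure_homothet[of 1 x K] K1 by (simp add: homothet_def)
  have lt: "(\<Sum>\<^sub>\<infinity> x \<in> S. 1) / ennreal c < ennreal \<theta>"
    using elim(1) unfolding S_def[symmetric] ce m1 by simp
  have "finite S"
  proof (rule ccontr)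
    assume "infinite S"
    then have "(\<Sum>\<^sub>\<infinity> x \<in> S. 1::ennreal) = \<infinity>"
      by (intro infsum_superconst_infinite_ennreal[of _ 1]) auto
    then show False using lt by (simp add: ennreal_top_divide)
  qed
  moreover have "real (card S) \<le> \<theta> * c"
  proof -
    have "ennreal (real (card S) / c) = (\<Sum>\<^sub>\<infinity> x \<in> S. 1) / ennreal c"
      using \<open>finite S\<close> c by (simp add: divide_ennreal[symmetric] ennreal_of_nat_eq_real_of_nat)
    also have "\<dots> < ennreal \<theta>" by (rule lt)
    finally have "real (card S) / c < \<theta>" using c by (simp add: ennreal_less_iff)
    then show ?thesis using c by (simp add: field_simps)
  qed
  ultimately show ?case by (simp add: S_def c_def)
qed

text \<open>Some shift of the covering is economical on the window \<^term>\<open>W\<close>: average over all shifts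
  in a large ball the number of its centres that fall into \<^term>\<open>W\<close>.\<close>

lemma economical_unit_cover:
  fixes K W A :: "'a::euclidean_space set"
  assumes K: "compact K" "emeasure lebesgue K = 1"
    and dens: "translative_covering_density K < ennreal \<theta>"
    and W: "open W" "bounded W"
    and AW: "\<And>x k. x \<in> A \<Longrightarrow> k \<in> K \<Longrightarrow> x - k \<in> W"
  shows "\<exists>Y. finite Y \<and> A \<subseteq> (\<Union>y\<in>Y. homothet y 1 K) \<and> real (card Y) \<le> \<theta> * measure lebesgue W"
proof (rule ccontr)
  assume no: "\<not> ?thesis"
  obtain X :: "'a set" where X: "(\<Union>x\<in>X. (+) x ` K) = UNIV" and lim: "Limsup at_top (\<lambda>r::real.
          (\<Sum>\<^sub>\<infinity> x \<in> {x\<in>X. (+) x ` K \<subseteq> cball 0 r}. emeasure lebesgue ((+) x ` K))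
          / emeasure lebesgue (cball (0::'a) r)) < ennreal \<theta>"
    using dens unfolding translative_covering_density_def INF_less_iff by auto
  define S where "S r = {x\<in>X. (+) x ` K \<subseteq> cball 0 r}" for r
  define V where "V = measure lebesgue W"
  define \<beta> where "\<beta> = measure lebesgue (cball (0::'a) 1)"
  \<comment> \<open>If no cover is economical, each count below is an integer above
    \<open>\<theta> * V\<close>, hence at least the fixed number \<open>n\<close>. This gap survives
    the limit in \<open>r\<close>.\<close>
  define n where "n = real_of_int (floor (\<theta> * V)) + 1"
  have n: "n > \<theta> * V" unfolding n_def by linarith
  have \<beta>: "\<beta> > 0" using content_cball_pos[of 1 "0::'a"] by (simp add: \<beta>_def)
  have V0: "V \<ge> 0" by (simp add: V_def)
  have th: "\<theta> > 0" using dens by (meson ennreal_less_zero_iff not_less_zero le_less_trans zero_le)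
  have Wm: "W \<in> sets lborel" using W by simp
  have Ve: "emeasure lborel W = ennreal V"
    using emeasure_eq_ennreal_measure[of lborel W] emeasure_bounded_finite[OF W(2)] Wm
    by (simp add: V_def less_top)
  obtain R0 where R0: "\<And>x. x \<in> K \<union> W \<Longrightarrow> norm x \<le> R0"
    using bounded_Un[of K W] compact_imp_bounded[OF K(1)] W(2) bounded_iff[of "K \<union> W"] by auto
  define R where "R = max R0 1"
  have R: "R > 0" "\<And>x. x \<in> K \<Longrightarrow> norm x \<le> R" "\<And>x. x \<in> W \<Longrightarrow> norm x \<le> R"
    using R0 by (force simp: R_def)+
  \<comment> \<open>Double counting of the pairs of a shift \<open>z\<close> in the ball and a
    centre \<open>x\<close> with \<open>x - z \<in> W\<close>. Such a centre has norm at most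
    \<open>r + R\<close> and its translate reaches at most \<open>R\<close> further, whence the
    radius \<open>r + 2*R\<close>.\<close>
  have cnt: "n * (r ^ DIM('a) * \<beta>) \<le> real (card (S (r + 2*R))) * V"
    if r: "r > 0" and fin: "finite (S (r + 2*R))" for r
  proof -
    let ?S = "S (r + 2*R)"
    have ge: "n \<le> real (card {x\<in>?S. x - z \<in> W})" if z: "z \<in> cball 0 r" for z
    proof -
      let ?Y = "(\<lambda>x. x - z) ` {x\<in>?S. x - z \<in> W}"
      have sub: "A \<subseteq> (\<Union>y\<in>?Y. homothet y 1 K)"
      proof
        fix a assume a: "a \<in> A"
        have "a + z \<in> (\<Union>x\<in>X. (+) x ` K)" unfolding X by simp
        then obtain x k where xk: "x \<in> X" "k \<in> K" "a + z = x + k" by blast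
        have e: "x - z = a - k" using xk(3) by (simp add: algebra_simps)
        have w: "x - z \<in> W" unfolding e using AW[OF a xk(2)] .
        have "(+) x ` K \<subseteq> cball 0 (r + 2*R)"
        proof (clarsimp)
          fix k' assume k': "k' \<in> K"
          have "norm (x + k') = norm ((x - z) + z + k')" by simp
          also have "\<dots> \<le> norm (x - z) + norm z + norm k'" by (metis add_mono norm_triangle_ineq norm_triangle_le order_refl)
          also have "\<dots> \<le> R + r + R" using R(3)[OF w] R(2)[OF k'] z by (simp add: add_mono)
          finally show "norm (x + k') \<le> r + 2*R" by simp
        qed
        then have "x \<in> ?S" using xk by (simp add: S_def)
        moreover have "a = (x - z) + 1 *\<^sub>R k" using e by simp
        ultimately show "a \<in> (\<Union>y\<in>?Y. homothet y 1 K)"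
          unfolding homothet_def using w xk(2) by blast
      qed
      have "finite ?Y" using fin by simp
      then have "\<theta> * V < real (card ?Y)"
        using no sub unfolding V_def not_le[symmetric] by blast
      also have "card ?Y = card {x\<in>?S. x - z \<in> W}" by (rule card_image) (simp add: inj_on_def)
      finally have "floor (\<theta> * V) < int (card {x\<in>?S. x - z \<in> W})" by (simp add: floor_less_iff)
      then show ?thesis unfolding n_def by linarith
    qed
    have Wx: "{z. x - z \<in> W} = (\<lambda>y. -1 *\<^sub>R y + x) ` W" for x
    proof (safe)
      fix z assume "x - z \<in> W" then show "z \<in> (\<lambda>y. - 1 *\<^sub>R y + x) ` W" by (intro image_eqI[of _ _ "x - z"]) auto
    qed auto
    have op: "open {z. x - z \<in> W}" for x
      using W(1) by (intro open_vimage[of W "\<lambda>z. x - z", unfolded vimage_def]) (auto intro: continuous_intros)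
    have Wxe: "emeasure lborel {z. x - z \<in> W} = ennreal V" for x
      using emeasure_lebesgue_affine[of "-1" x W] Ve op[of x] Wm unfolding Wx by simp
    have ball: "emeasure lborel (cball (0::'a) r) = ennreal (r ^ DIM('a) * \<beta>)"
      using emeasure_eq_ennreal_measure[of lborel "cball (0::'a) r"] emeasure_lborel_cball_finite[of "0::'a" r]
        measure_cball_conv_unit[where 'a='a, of r] r
      by (simp add: \<beta>_def less_top)
    have "ennreal (n * (r ^ DIM('a) * \<beta>)) = (\<integral>\<^sup>+z. ennreal n * indicator (cball (0::'a) r) z \<partial>lborel)"
      using ball n th V0 by (simp add: nn_integral_cmult_indicator ennreal_mult'' r \<beta> less_imp_le)
    also have "\<dots> \<le> (\<integral>\<^sup>+z. (\<Sum>x\<in>?S. indicator {z. x - z \<in> W} z) \<partial>lborel)"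
    proof (rule nn_integral_mono)
      fix z :: 'a
      have "(\<Sum>x\<in>?S. indicator {z. x - z \<in> W} z) = (of_nat (card {x\<in>?S. x - z \<in> W}) :: ennreal)"
        using fin by (simp add: indicator_def if_distrib sum.If_cases Int_def)
      then show "ennreal n * indicator (cball (0::'a) r) z \<le> (\<Sum>x\<in>?S. indicator {z. x - z \<in> W} z)"
        using ge[of z] by (auto simp: indicator_def ennreal_of_nat_eq_real_of_nat intro!: ennreal_leI)
    qed
    also have "\<dots> = (\<Sum>x\<in>?S. emeasure lborel {z. x - z \<in> W})"
      using op by (subst nn_integral_sum) (auto intro!: sum.cong borel_measurable_indicator)
    also have "\<dots> = ennreal (real (card ?S) * V)"
      unfolding Wxe using V0 by (simp add: ennreal_mult'' ennreal_of_nat_eq_real_of_nat)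
    finally show ?thesis using V0 by (subst (asm) ennreal_le_iff) auto
  qed
  have "\<forall>\<^sub>F r in at_top. finite (S r) \<and> real (card (S r)) \<le> \<theta> * measure lebesgue (cball (0::'a) r)"
    using eventually_card_le_density[OF K(2) lim] by (simp add: S_def)
  then have "\<forall>\<^sub>F r in at_top. finite (S (r+2*R)) \<and> real (card (S (r+2*R))) \<le> \<theta> * measure lebesgue (cball (0::'a) (r+2*R))"
    unfolding eventually_at_top_linorder by (metis R(1) add_increasing2 less_imp_le mult_nonneg_nonneg zero_le_numeral)
  then have ev: "\<forall>\<^sub>F r in at_top. n \<le> \<theta> * V * ((r + 2*R) / r) ^ DIM('a)"
    using eventually_gt_at_top[of 0]
  proof eventually_elim
    case (elim r)
    have "n * (r ^ DIM('a) * \<beta>) \<le> real (card (S (r + 2*R))) * V" using cnt elim by blast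
    also have "\<dots> \<le> \<theta> * ((r+2*R) ^ DIM('a) * \<beta>) * V"
      using elim R(1) measure_cball_conv_unit[where 'a='a, of "r+2*R"] V0
      by (intro mult_right_mono) (auto simp: \<beta>_def)
    finally have "\<beta> * (n * r ^ DIM('a)) \<le> \<beta> * (\<theta> * (r+2*R) ^ DIM('a) * V)" by (simp add: mult_ac)
    then have "n * r ^ DIM('a) \<le> \<theta> * (r+2*R) ^ DIM('a) * V" using \<beta> by simp
    then show ?case using elim by (simp add: power_divide pos_le_divide_eq mult_ac)
  qed
  \<comment> \<open>The shell between the two balls is negligible in the limit.\<close>
  have "((\<lambda>r. (r + 2*R) / r) \<longlongrightarrow> 1) at_top"
    by real_asymp
  then have "((\<lambda>r. \<theta> * V * ((r + 2*R) / r) ^ DIM('a)) \<longlongrightarrow> \<theta> * V * 1 ^ DIM('a)) at_top"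
    by (intro tendsto_intros)
  then have "n \<le> \<theta> * V * 1 ^ DIM('a)"
    using ev by (intro tendsto_lowerbound[of _ _ at_top]) auto
  then show False using n by simp
qed

text \<open>This is the form in which the density bound is used: for \<open>K\<close> of volume one,
  the copies have total volume at most \<open>\<theta>\<close> times that of \<open>W\<close>, at
  every scale \<open>l\<close>. The set \<open>A\<close> is arbitrary; only the window
  \<open>W\<close>, which contains \<open>A - l K\<close>, is measured.\<close>

definition economical :: "real \<Rightarrow> 'a::euclidean_space set \<Rightarrow> bool" where
  "economical \<theta> K \<longleftrightarrow> (\<forall>A W l. open W \<longrightarrow> bounded W \<longrightarrow> l > 0 \<longrightarrow>
     (\<forall>x\<in>A. \<forall>k\<in>K. x - l *\<^sub>R k \<in> W) \<longrightarrow>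
     (\<exists>Y. finite Y \<and> A \<subseteq> (\<Union>y\<in>Y. homothet y l K) \<and>
          real (card Y) * l ^ DIM('a) \<le> \<theta> * measure lebesgue W))"

lemma economicalD:
  fixes K :: "'a::euclidean_space set"
  assumes "economical \<theta> K" "open W" "bounded W" "l > 0" "\<And>x k. x \<in> A \<Longrightarrow> k \<in> K \<Longrightarrow> x - l *\<^sub>R k \<in> W"
  obtains Y where "finite Y" "A \<subseteq> (\<Union>y\<in>Y. homothet y l K)"
    "real (card Y) * l ^ DIM('a) \<le> \<theta> * measure lebesgue W"
  using assms unfolding economical_def by meson

text \<open>Scaling by \<open>1 / l\<close> turns copies of ratio \<open>l\<close> into translates,
  to which \<open>economical_unit_cover\<close> applies.\<close>

lemma economical_if_density_less:
  fixes K :: "'a::euclidean_space set"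
  assumes K: "compact K" "emeasure lebesgue K = 1"
    and dens: "translative_covering_density K < ennreal \<theta>"
  shows "economical \<theta> K"
  unfolding economical_def
proof (intro allI impI)
  fix A W :: "'a set" and l :: real
  assume W: "open W" "bounded W" and l: "l > 0" and AW: "\<forall>x\<in>A. \<forall>k\<in>K. x - l *\<^sub>R k \<in> W"
  let ?A = "(*\<^sub>R) (1/l) ` A" and ?W = "(*\<^sub>R) (1/l) ` W"
  have "x - k \<in> ?W" if "x \<in> ?A" "k \<in> K" for x k
  proof -
    obtain a where a: "a \<in> A" "x = (1/l) *\<^sub>R a" using \<open>x \<in> ?A\<close> by auto
    have "x - k = (1/l) *\<^sub>R (a - l *\<^sub>R k)" using a l by (simp add: scaleR_diff_right)
    then show ?thesis using AW a \<open>k \<in> K\<close> by blast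
  qed
  moreover have "open ?W" "bounded ?W" using W l by (auto intro: open_scaling bounded_scaling)
  ultimately obtain Y where Y: "finite Y" "?A \<subseteq> (\<Union>y\<in>Y. homothet y 1 K)"
      "real (card Y) \<le> \<theta> * measure lebesgue ?W"
    using economical_unit_cover[OF K dens, of ?W ?A] by blast
  let ?Y = "(*\<^sub>R) l ` Y"
  have "A \<subseteq> (\<Union>y\<in>?Y. homothet y l K)"
  proof
    fix a assume "a \<in> A"
    then obtain y k where yk: "y \<in> Y" "k \<in> K" "(1/l) *\<^sub>R a = y + k"
      using Y(2) by (force simp: homothet_def)
    have "a = l *\<^sub>R ((1/l) *\<^sub>R a)" using l by simp
    also have "\<dots> = l *\<^sub>R y + l *\<^sub>R k" unfolding yk(3) by (simp add: scaleR_add_right)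
    finally show "a \<in> (\<Union>y\<in>?Y. homothet y l K)"
      unfolding homothet_def using yk(1,2) by blast
  qed
  moreover have "card ?Y = card Y"
    using l by (intro card_image) (simp add: inj_on_def)
  moreover have "measure lebesgue ?W = (1/l) ^ DIM('a) * measure lebesgue W"
    using measure_homothet[of "1/l" 0 W] l by (simp add: homothet_def)
  ultimately show "\<exists>Y. finite Y \<and> A \<subseteq> (\<Union>y\<in>Y. homothet y l K) \<and>
          real (card Y) * l ^ DIM('a) \<le> \<theta> * measure lebesgue W"
    using Y(1,3) l mult_right_mono[OF Y(3), of "l ^ DIM('a)"]
    by (intro exI[of _ ?Y]) (simp add: power_one_over)
qed

lemma homothet_translate: "homothet y l ((+) p ` K) = homothet (y + l *\<^sub>R p) l K"
  by (simp add: homothet_def image_image scaleR_add_right add.assoc)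

text \<open>Covering \<open>A\<close> by copies of \<open>p + K\<close> amounts to covering
  \<open>A - l p\<close> by copies of \<open>K\<close>, with the same centres.\<close>

lemma economical_translate:
  fixes K :: "'a::euclidean_space set"
  assumes "economical \<theta> K"
  shows "economical \<theta> ((+) p ` K)"
  unfolding economical_def
proof (intro allI impI)
  fix A W :: "'a set" and l :: real
  assume W: "open W" "bounded W" and l: "l > 0" and AW: "\<forall>x\<in>A. \<forall>k\<in>(+) p ` K. x - l *\<^sub>R k \<in> W"
  have "x - l *\<^sub>R k \<in> W" if x: "x \<in> (\<lambda>a. a - l *\<^sub>R p) ` A" "k \<in> K" for x k
  proof -
    obtain a where a: "a \<in> A" "x = a - l *\<^sub>R p" using x(1) by blast
    then have "x - l *\<^sub>R k = a - l *\<^sub>R (p + k)" by (simp add: scaleR_add_right)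
    then show ?thesis using AW a(1) x(2) by auto
  qed
  from economicalD[OF assms W l this]
  obtain Y where Y: "finite Y" "(\<lambda>a. a - l *\<^sub>R p) ` A \<subseteq> (\<Union>y\<in>Y. homothet y l K)"
    "real (card Y) * l ^ DIM('a) \<le> \<theta> * measure lebesgue W"
    by blast
  have "A \<subseteq> (\<Union>y\<in>Y. homothet y l ((+) p ` K))"
  proof
    fix a assume "a \<in> A"
    then obtain y k where yk: "y \<in> Y" "k \<in> K" "a - l *\<^sub>R p = y + l *\<^sub>R k"
      using Y(2) by (auto simp: homothet_def image_subset_iff)
    then have "a = y + l *\<^sub>R (p + k)" by (simp add: algebra_simps)
    then have "a \<in> homothet y l ((+) p ` K)"
      using yk(2) unfolding homothet_def image_image by (intro image_eqI[of _ _ k]) auto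
    then show "a \<in> (\<Union>y\<in>Y. homothet y l ((+) p ` K))"
      using yk(1) by (rule UN_I[rotated])
  qed
  then show "\<exists>Y. finite Y \<and> A \<subseteq> (\<Union>y\<in>Y. homothet y l ((+) p ` K)) \<and>
          real (card Y) * l ^ DIM('a) \<le> \<theta> * measure lebesgue W"
    using Y by (intro exI[of _ Y] conjI)
qed

section \<open>Greedy covering with homothets of widely separated sizes\<close>

lemma covers_with_mono:
  assumes "covers_with L r K A" "L \<subseteq> J" "B \<subseteq> A"
  shows "covers_with J r K B"
  using assms unfolding covers_with_def by blast

lemma covers_with_Un:
  assumes "covers_with L r K A" "covers_with M r K B" "L \<inter> M = {}"
  shows "covers_with (L \<union> M) r K (A \<union> B)"
proof -
  obtain t u where tu: "A \<subseteq> (\<Union>i\<in>L. homothet (t i) (r i) K)" "B \<subseteq> (\<Union>i\<in>M. homothet (u i) (r i) K)"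
    using assms unfolding covers_with_def by blast
  define v where "v i = (if i \<in> L then t i else u i)" for i
  have "v i = t i" if "i \<in> L" for i using that by (simp add: v_def)
  moreover have "v i = u i" if "i \<in> M" for i using that assms(3) by (auto simp: v_def)
  ultimately have "(\<Union>i\<in>L. homothet (t i) (r i) K) = (\<Union>i\<in>L. homothet (v i) (r i) K)"
    "(\<Union>i\<in>M. homothet (u i) (r i) K) = (\<Union>i\<in>M. homothet (v i) (r i) K)"
    by simp_all
  then have "A \<union> B \<subseteq> (\<Union>i\<in>L \<union> M. homothet (v i) (r i) K)"
    using tu unfolding UN_Un by (intro Un_mono) simp_all
  then show ?thesis unfolding covers_with_def by (rule exI[where x = v])
qed

text \<open>The centres inject into the members of common ratio. Members outside the image receive
  the unspecified value of \<open>inv_into\<close>, which does no harm.\<close>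

lemma covers_with_constant:
  assumes "finite L" "finite Y" "card Y \<le> card L" "\<And>i. i \<in> L \<Longrightarrow> r i = \<rho>"
    and "A \<subseteq> (\<Union>y\<in>Y. homothet y \<rho> K)"
  shows "covers_with L r K A"
proof -
  obtain f where f: "f ` Y \<subseteq> L" "inj_on f Y" using card_le_inj[OF assms(2,1,3)] by blast
  have "homothet y \<rho> K \<subseteq> (\<Union>i\<in>L. homothet (inv_into Y f i) (r i) K)" if "y \<in> Y" for y
  proof -
    have "f y \<in> L" "inv_into Y f (f y) = y" "r (f y) = \<rho>" using that f assms(4)[of "f y"] by auto
    then show ?thesis using UN_upper[of "f y" L "\<lambda>i. homothet (inv_into Y f i) (r i) K"] by simp
  qed
  then have "A \<subseteq> (\<Union>i\<in>L. homothet (inv_into Y f i) (r i) K)" using assms(5) by blast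
  then show ?thesis unfolding covers_with_def by (rule exI[where x = "inv_into Y f"])
qed

text \<open>Greedy choice: the \<open>n\<close> cells not yet chosen cover what is left of
  \<open>B\<close>, so one of them covers at least a share \<open>1 / n\<close> of it. The resulting
  factors \<open>(n - 1) / n\<close> telescope.\<close>

lemma exists_subfamily_covering_fraction:
  assumes "finite Y" "B \<in> lmeasurable" "\<And>y. y \<in> Y \<Longrightarrow> C y \<in> lmeasurable" "B \<subseteq> (\<Union>y\<in>Y. C y)"
    and "M \<le> card Y"
  shows "\<exists>Z\<subseteq>Y. card Z = M \<and>
    real (card Y) * measure lebesgue (B - (\<Union>y\<in>Z. C y)) \<le> real (card Y - M) * measure lebesgue B"
  using \<open>M \<le> card Y\<close>
proof (induction M)
  case 0
  then show ?case by (intro exI[of _ "{}"]) auto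
next
  case (Suc M)
  then obtain Z where Z: "Z \<subseteq> Y" "card Z = M"
    "real (card Y) * measure lebesgue (B - (\<Union>y\<in>Z. C y)) \<le> real (card Y - M) * measure lebesgue B"
    by auto
  have finZ: "finite Z" using Z assms finite_subset by blast
  define R where "R = B - (\<Union>y\<in>Z. C y)"
  define n where "n = card Y - M"
  have n: "n > 0" "card (Y - Z) = n" using Suc Z finZ by (auto simp: n_def card_Diff_subset)
  have CZ: "(\<Union>y\<in>Z. C y) \<in> lmeasurable"
    using assms Z finZ by (intro fmeasurable.finite_UN) auto
  have R: "R \<in> lmeasurable" unfolding R_def using assms CZ by auto
  have "\<exists>y\<in>Y-Z. measure lebesgue R \<le> real n * measure lebesgue (R \<inter> C y)"
  proof (rule ccontr)
    assume a: "\<not> ?thesis"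
    have "R \<subseteq> (\<Union>y\<in>Y-Z. R \<inter> C y)" using assms(4) unfolding R_def by blast
    then have "measure lebesgue R \<le> measure lebesgue (\<Union>y\<in>Y-Z. R \<inter> C y)"
      using R assms by (intro measure_mono_fmeasurable) (auto intro!: fmeasurable.finite_UN fmeasurable.Int)
    also have "\<dots> \<le> (\<Sum>y\<in>Y-Z. measure lebesgue (R \<inter> C y))"
      using R assms by (intro measure_UNION_le) (auto dest: fmeasurableD)
    also have "\<dots> < (\<Sum>y\<in>Y-Z. measure lebesgue R / real n)"
    proof (rule sum_strict_mono)
      show "Y - Z \<noteq> {}"
      proof
        assume "Y - Z = {}"
        then have "card (Y - Z) = 0" by (simp only: card.empty)
        then show False using n by simp
      qed
    qed (use a assms n in \<open>auto simp: field_simps not_le\<close>)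
    also have "\<dots> = measure lebesgue R" using n by simp
    finally show False by simp
  qed
  then obtain y where y: "y \<in> Y" "y \<notin> Z" "measure lebesgue R \<le> real n * measure lebesgue (R \<inter> C y)"
    by blast
  have split: "measure lebesgue (R - C y) = measure lebesgue R - measure lebesgue (R \<inter> C y)"
    using R assms(3)[OF y(1)] measurable_measure_Diff[of R lebesgue "R \<inter> C y"]
    by (simp add: Diff_Int fmeasurableD fmeasurable.Int)
  have "real n * (real (card Y) * measure lebesgue (R - C y))
      = real (card Y) * (real n * measure lebesgue R - real n * measure lebesgue (R \<inter> C y))"
    unfolding split by (simp add: algebra_simps)
  also have "\<dots> \<le> real (card Y) * (real n * measure lebesgue R - measure lebesgue R)"
    using y by (intro mult_left_mono) auto
  also have "\<dots> = (real n - 1) * (real (card Y) * measure lebesgue R)" by (simp add: algebra_simps)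
  also have "\<dots> \<le> (real n - 1) * (real n * measure lebesgue B)"
    using Z(3) n unfolding R_def[symmetric] n_def[symmetric] by (intro mult_left_mono) auto
  finally have "real (card Y) * measure lebesgue (R - C y) \<le> (real n - 1) * measure lebesgue B"
    using n by (simp add: mult.left_commute)
  moreover have "R - C y = B - (\<Union>y\<in>insert y Z. C y)" unfolding R_def by auto
  moreover have "real n - 1 = real (card Y - Suc M)" using Suc.prems by (simp add: n_def of_nat_diff)
  ultimately show ?case using y Z finZ by (intro exI[of _ "insert y Z"]) auto
qed

text \<open>The complement is the Minkowski sum of the closed set \<open>-W\<close> and the compact
  set \<open>C\<close>, hence closed.\<close>

lemma open_erosion:
  fixes W C :: "'a::real_normed_vector set"
  assumes "open W" "compact C"
  shows "open {x. \<forall>c\<in>C. x - c \<in> W}"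
proof -
  have "- {x. \<forall>c\<in>C. x - c \<in> W} = (\<Union>x\<in> -W. \<Union>y\<in>C. {x + y})"
  proof (rule set_eqI)
    fix x :: 'a
    have "x = w + c \<longleftrightarrow> w = x - c" for w c by (auto simp: eq_diff_eq)
    then show "x \<in> - {x. \<forall>c\<in>C. x - c \<in> W} \<longleftrightarrow> x \<in> (\<Union>x\<in> -W. \<Union>y\<in>C. {x + y})"
      by auto
  qed
  then show ?thesis
    using closed_compact_sums[of "-W" C] assms by (simp add: open_closed)
qed

text \<open>Dividing \<open>a k + b k'\<close> by \<open>a + b\<close> gives a point of
  \<open>K\<close>, and the remaining factor \<open>(a + b) / c\<close> moves it towards the origin.
  This is the inclusion \<open>a K + b K \<subseteq> c K\<close>.\<close>

lemma convex_sum_scaled: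
  assumes "convex K" "0 \<in> K" "k \<in> K" "k' \<in> K" "0 \<le> a" "0 \<le> b" "a + b \<le> c" "c > 0"
  shows "\<exists>z\<in>K. a *\<^sub>R k + b *\<^sub>R k' = c *\<^sub>R z"
proof (cases "a + b = 0")
  case True
  then show ?thesis using assms by (intro bexI[of _ 0]) (auto simp: add_nonneg_eq_0_iff)
next
  case False
  define m where "m = (a/(a+b)) *\<^sub>R k + (b/(a+b)) *\<^sub>R k'"
  have "m \<in> K"
    unfolding m_def using assms False by (intro convexD) (auto simp: add_divide_distrib[symmetric])
  then have "((a+b)/c) *\<^sub>R m + (1 - (a+b)/c) *\<^sub>R 0 \<in> K"
    using assms by (intro convexD) auto
  moreover have "a *\<^sub>R k + b *\<^sub>R k' = c *\<^sub>R (((a+b)/c) *\<^sub>R m + (1 - (a+b)/c) *\<^sub>R 0)"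
    using assms False by (simp add: m_def scaleR_add_right)
  ultimately show ?thesis by blast
qed


text \<open>The shrinking is what makes the volume bookkeeping close up: if \<open>x\<close> lies outside \<open>y + \<rho> K\<close>, then
  all of \<open>x - \<epsilon> \<rho> K\<close> lies outside \<open>y + (1 - \<epsilon>) \<rho> K\<close>, so the invariant \<open>A - r\<^sub>i K \<subseteq> W\<close> survives
  for the smaller ratios when \<open>W\<close> loses only the shrunk homothets. Openness of \<open>W\<close> keeps everything
  measurable although \<open>A\<close> is arbitrary.\<close>

lemma greedy_multiscale_cover:
  fixes K :: "'a::euclidean_space set"
  assumes K: "compact K" "convex K" "0 \<in> K" "emeasure lebesgue K = 1"
    and econ: "economical \<theta> K" and \<theta>: "\<theta> > 0" and \<epsilon>: "0 < \<epsilon>" "\<epsilon> < 1"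
    and J: "finite J" "\<And>i. i \<in> J \<Longrightarrow> r i > 0"
      "\<And>i j. i \<in> J \<Longrightarrow> j \<in> J \<Longrightarrow> r i < r j \<Longrightarrow> r i \<le> \<epsilon> * r j"
    and W: "open W" "bounded W" "\<And>i x k. i \<in> J \<Longrightarrow> x \<in> A \<Longrightarrow> k \<in> K \<Longrightarrow> x - r i *\<^sub>R k \<in> W"
    and large: "\<theta> * measure lebesgue W < (\<Sum>i\<in>J. ((1 - \<epsilon>) * r i) ^ DIM('a))"
  shows "covers_with J r K A"
  using J W large
proof (induction J arbitrary: A W rule: finite_psubset_induct)
  case (psubset J)
  note Jpos = psubset.prems(1) and Jgap = psubset.prems(2) and W = psubset.prems(3,4)
    and AW = psubset.prems(5) and large = psubset.prems(6)
  have "0 \<le> \<theta> * measure lebesgue W" using \<theta> by simp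
  \<comment> \<open>The strict inequality \<open>large\<close> excludes the empty family, so the
    induction can only end when every centre has been occupied.\<close>
  then have "J \<noteq> {}" using large by auto
  define \<rho> where "\<rho> = Max (r ` J)"
  have "\<rho> \<in> r ` J" unfolding \<rho>_def using \<open>J \<noteq> {}\<close> psubset.hyps by (intro Max_in) auto
  then obtain j0 where j0: "j0 \<in> J" "r j0 = \<rho>" by blast
  have le\<rho>: "r i \<le> \<rho>" if "i \<in> J" for i unfolding \<rho>_def using that psubset.hyps by simp
  have \<rho>: "\<rho> > 0" using j0 Jpos by blast
  define L where "L = {i\<in>J. r i = \<rho>}"
  have L: "finite L" "L \<subseteq> J" "L \<noteq> {}" "\<And>i. i \<in> L \<Longrightarrow> r i = \<rho>"
    using psubset.hyps j0 by (auto simp: L_def)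
  define s where "s = (1 - \<epsilon>) * \<rho>"
  have s: "s > 0" using \<rho> \<epsilon> by (simp add: s_def)
  \<comment> \<open>\<open>B\<close> consists of the points \<open>x\<close> with
    \<open>x - s K \<subseteq> W\<close>, so a covering of \<open>B\<close> by copies of ratio
    \<open>s\<close> is charged to \<open>W\<close>. Since
    \<open>\<epsilon> * \<rho> + s = \<rho>\<close>, the set \<open>A - \<epsilon> \<rho> K\<close>
    lies in \<open>B\<close>.\<close>
  define B where "B = {x. \<forall>c\<in>(*\<^sub>R) s ` K. x - c \<in> W}"
  have Bop: "open B" unfolding B_def
    using W(1) K(1) by (intro open_erosion compact_scaling)
  have BW: "B \<subseteq> W" using K(3) by (auto simp: B_def)
  have Bbd: "bounded B" using W(2) BW bounded_subset by blast
  have Wm: "W \<in> lmeasurable" and Bm: "B \<in> lmeasurable"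
    using W Bop Bbd by (auto simp: lmeasurable_open)
  have mBW: "measure lebesgue B \<le> measure lebesgue W"
    using BW Bm Wm by (intro measure_mono_fmeasurable) auto
  have "x - s *\<^sub>R k \<in> W" if "x \<in> B" "k \<in> K" for x k using that by (auto simp: B_def)
  from economicalD[OF econ W s this] obtain Y where Y: "finite Y" "B \<subseteq> (\<Union>y\<in>Y. homothet y s K)"
    "real (card Y) * s ^ DIM('a) \<le> \<theta> * measure lebesgue W"
    by blast
  have AB: "x - (\<epsilon> * \<rho>) *\<^sub>R k \<in> B" if "x \<in> A" "k \<in> K" for x k
    unfolding B_def
  proof clarsimp
    fix k' assume "k' \<in> K"
    then obtain z where "z \<in> K" "(\<epsilon> * \<rho>) *\<^sub>R k + s *\<^sub>R k' = \<rho> *\<^sub>R z"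
      using convex_sum_scaled[OF K(2,3) \<open>k \<in> K\<close>, of k' "\<epsilon> * \<rho>" s \<rho>] \<epsilon> \<rho> s
      by (auto simp: s_def algebra_simps)
    then show "x - (\<epsilon> * \<rho>) *\<^sub>R k - s *\<^sub>R k' \<in> W"
      using AW[OF j0(1) \<open>x \<in> A\<close>, of z] j0(2) by (simp add: diff_diff_eq)
  qed
  have grow: "x \<in> homothet y \<rho> K"
    if x: "x - a *\<^sub>R k \<in> homothet y s K" "k \<in> K" and a: "0 \<le> a" "a \<le> \<epsilon> * \<rho>" for x y k a
  proof -
    obtain k' where k': "k' \<in> K" "x - a *\<^sub>R k = y + s *\<^sub>R k'" using x by (auto simp: homothet_def)
    obtain z where "z \<in> K" "a *\<^sub>R k + s *\<^sub>R k' = \<rho> *\<^sub>R z"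
      using convex_sum_scaled[OF K(2,3) x(2) k'(1), of a s \<rho>] a \<rho> s
      by (auto simp: s_def algebra_simps)
    moreover have "x = y + (a *\<^sub>R k + s *\<^sub>R k')" using k'(2) by (simp add: algebra_simps)
    ultimately show ?thesis unfolding homothet_def by (intro image_eqI[of _ _ z]) auto
  qed
  show ?case
  \<comment> \<open>Either the largest homothets suffice for all centres, or they are spent on the
    best centres and the smaller ones must cover the rest.\<close>
  proof (cases "card Y \<le> card L")
    case True
    have "A \<subseteq> (\<Union>y\<in>Y. homothet y \<rho> K)"
    proof
      fix x assume "x \<in> A"
      then have "x \<in> B" using AB[of x 0] K(3) by simp
      then obtain y where y: "y \<in> Y" "x \<in> homothet y s K" using Y(2) by blast
      then have "x \<in> homothet y \<rho> K"
        using grow[of x 0 0 y] K(3) \<epsilon> \<rho> by simp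
      then show "x \<in> (\<Union>y\<in>Y. homothet y \<rho> K)" using y by blast
    qed
    then show ?thesis
      using covers_with_constant[of L Y r \<rho>] L Y(1) True covers_with_mono[of L r K A J A] by simp
  next
    case False
    have Cm: "compact (homothet y l K)" for y l
      unfolding homothet_def using K(1) by (intro compact_affinity)
    obtain Z where Z: "Z \<subseteq> Y" "card Z = card L"
      "real (card Y) * measure lebesgue (B - (\<Union>y\<in>Z. homothet y s K)) \<le> real (card Y - card L) * measure lebesgue B"
      using exists_subfamily_covering_fraction[OF Y(1) Bm _ Y(2), of "card L"] Cm lmeasurable_compact False by auto
    have finZ: "finite Z" using Z Y finite_subset by blast
    define A' where "A' = A - (\<Union>y\<in>Z. homothet y \<rho> K)"
    define W' where "W' = B - (\<Union>y\<in>Z. homothet y s K)"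
    have W': "open W'" "bounded W'"
      unfolding W'_def using Bop Bbd finZ Cm
      by (auto intro!: open_Diff closed_UN compact_imp_closed intro: bounded_subset)
    have "covers_with (J - L) r K A'"
    proof (rule psubset.IH[OF _ _ _ W'])
      show "J - L \<subset> J" using L by blast
      show "x - r i *\<^sub>R k \<in> W'" if i: "i \<in> J - L" and x: "x \<in> A'" and k: "k \<in> K" for i x k
      proof -
        have ri: "0 < r i" "r i \<le> \<epsilon> * \<rho>"
          using Jgap[of i j0] i j0 le\<rho>[of i] Jpos[of i] by (auto simp: L_def)
        obtain z where z: "z \<in> K" "r i *\<^sub>R k = (\<epsilon> * \<rho>) *\<^sub>R z"
          using convex_sum_scaled[OF K(2,3) k K(3), of "r i" 0 "\<epsilon> * \<rho>"] ri by auto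
        have "x - r i *\<^sub>R k \<in> B" unfolding z(2) using AB[of x z] x z(1) by (auto simp: A'_def)
        moreover have "x - r i *\<^sub>R k \<notin> homothet y s K" if "y \<in> Z" for y
          using grow[of x "r i" k y] k ri that x by (auto simp: A'_def)
        ultimately show ?thesis by (simp add: W'_def)
      qed
      let ?S = "\<lambda>J. \<Sum>i\<in>J. ((1 - \<epsilon>) * r i) ^ DIM('a)"
      have N: "real (card Y) > 0" using False by simp
      have SL: "?S L = real (card L) * s ^ DIM('a)"
        using L(4) by (simp add: s_def)
      \<comment> \<open>The chosen centres remove at least the proportion
        \<open>card L / card Y\<close> of the volume. Because \<open>card Y * s ^ DIM('a)\<close> is
        at most \<open>\<theta> * measure lebesgue W\<close>, the left side of \<open>large\<close>
        drops by at least \<open>?S L\<close>, which is what the right side loses.\<close>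
      have "real (card Y) * measure lebesgue W' \<le> (real (card Y) - real (card L)) * measure lebesgue W"
      proof -
        have "(real (card Y) - real (card L)) * measure lebesgue B \<le> (real (card Y) - real (card L)) * measure lebesgue W"
          using False mBW by (intro mult_left_mono) auto
        moreover have "real (card Y - card L) = real (card Y) - real (card L)"
          using False by (simp add: of_nat_diff)
        ultimately show ?thesis using order_trans[OF Z(3)] unfolding W'_def by simp
      qed
      from mult_left_mono[OF this less_imp_le[OF \<theta>]]
      have "real (card Y) * (\<theta> * measure lebesgue W')
          \<le> real (card Y) * (\<theta> * measure lebesgue W) - real (card L) * (\<theta> * measure lebesgue W)"
        by (simp add: algebra_simps)
      also have "\<dots> \<le> real (card Y) * (\<theta> * measure lebesgue W) - real (card L) * (real (card Y) * s ^ DIM('a))"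
        using Y(3) by (intro diff_left_mono mult_left_mono) auto
      also have "\<dots> = real (card Y) * (\<theta> * measure lebesgue W - ?S L)"
        unfolding SL by (simp add: algebra_simps)
      finally have "\<theta> * measure lebesgue W' \<le> \<theta> * measure lebesgue W - ?S L"
        using N by simp
      also have "\<dots> < ?S J - ?S L" using large by simp
      also have "\<dots> = ?S (J - L)" using L psubset.hyps by (simp add: sum_diff)
      finally show "\<theta> * measure lebesgue W' < ?S (J - L)" .
    qed (use Jpos Jgap in auto)
    moreover have "covers_with L r K (\<Union>y\<in>Z. homothet y \<rho> K)"
      using covers_with_constant[of L Z r \<rho>] L finZ Z(2) by simp
    ultimately have "covers_with (L \<union> (J - L)) r K ((\<Union>y\<in>Z. homothet y \<rho> K) \<union> A')"
      by (intro covers_with_Un) auto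
    then show ?thesis by (rule covers_with_mono) (use L in \<open>auto simp: A'_def\<close>)
  qed
qed

section \<open>Dyadic coverings of parallelotopes\<close>

lemma homothet_homothet: "homothet t l (homothet u m K) = homothet (t + l *\<^sub>R u) (l * m) K"
  by (simp add: homothet_def image_image scaleR_add_right add.assoc)

lemma homothet_mono: "A \<subseteq> B \<Longrightarrow> homothet t l A \<subseteq> homothet t l B"
  unfolding homothet_def by (rule image_mono)

lemma homothet_UN: "homothet t l (\<Union>i\<in>I. A i) = (\<Union>i\<in>I. homothet t l (A i))"
  unfolding homothet_def by (rule image_UN)

text \<open>Up to the shift by \<open>(m - l) p\<close>, the point \<open>l k\<close> is
  \<open>m\<close> times a convex combination of \<open>k\<close> and \<open>p\<close>.\<close>

lemma convex_homothet_subset_larger: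
  fixes K :: "'a::real_vector set"
  assumes "convex K" "p \<in> K" "0 < l" "l \<le> m"
  shows "homothet t l K \<subseteq> homothet (t - (m - l) *\<^sub>R p) m K"
proof
  fix x assume "x \<in> homothet t l K"
  then obtain k where k: "k \<in> K" "x = t + l *\<^sub>R k" by (auto simp: homothet_def)
  have "(l/m) *\<^sub>R k + ((m-l)/m) *\<^sub>R p \<in> K"
    using assms k by (intro convexD) (auto simp: diff_divide_distrib)
  moreover have "x = t - (m - l) *\<^sub>R p + m *\<^sub>R ((l/m) *\<^sub>R k + ((m-l)/m) *\<^sub>R p)"
    using assms k by (simp add: scaleR_add_right)
  ultimately show "x \<in> homothet (t - (m - l) *\<^sub>R p) m K" unfolding homothet_def by blast
qed

lemma covers_with_replace:
  assumes "covers_with J r P A" and "\<And>i t. i \<in> J \<Longrightarrow> \<exists>t'. homothet t (r i) P \<subseteq> homothet t' (l i) K"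
  shows "covers_with J l K A"
proof -
  obtain t where t: "A \<subseteq> (\<Union>i\<in>J. homothet (t i) (r i) P)" using assms(1) by (auto simp: covers_with_def)
  have "\<forall>i\<in>J. \<exists>t'. homothet (t i) (r i) P \<subseteq> homothet t' (l i) K" using assms(2) by blast
  then obtain u where u: "\<forall>i\<in>J. homothet (t i) (r i) P \<subseteq> homothet (u i) (l i) K" by metis
  have "(\<Union>i\<in>J. homothet (t i) (r i) P) \<subseteq> (\<Union>i\<in>J. homothet (u i) (l i) K)"
    using u by (intro UN_mono) auto
  then show ?thesis using t unfolding covers_with_def by (intro exI[of _ u]) simp
qed

text \<open>This allows a covering to be built with ratios rounded down and then to be realised by
  the given larger homothets.\<close>

lemma covers_with_enlarge:
  assumes "covers_with J r K A" "convex K" "K \<noteq> {}" "\<And>i. i \<in> J \<Longrightarrow> 0 < r i \<and> r i \<le> l i"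
  shows "covers_with J l K A"
  using assms(1)
proof (rule covers_with_replace)
  obtain p where "p \<in> K" using assms(3) by blast
  then show "\<exists>t'. homothet t (r i) K \<subseteq> homothet t' (l i) K" if "i \<in> J" for i t
    using convex_homothet_subset_larger[OF assms(2)] assms(4)[OF that] by blast
qed

lemma covers_with_single:
  assumes "convex K" "K \<noteq> {}" "i \<in> J" "l i \<ge> 1"
  shows "covers_with J l K K"
proof -
  obtain p where "p \<in> K" using assms(2) by blast
  then have "homothet 0 1 K \<subseteq> homothet (0 - (l i - 1) *\<^sub>R p) (l i) K"
    using assms by (intro convex_homothet_subset_larger) auto
  then have "K \<subseteq> homothet (0 - (l i - 1) *\<^sub>R p) (l i) K" by (simp add: homothet_def)
  then show ?thesis
    using assms(3) unfolding covers_with_def by (intro exI[of _ "\<lambda>_. 0 - (l i - 1) *\<^sub>R p"] order_trans[OF _ UN_upper[of i]])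
qed

text \<open>Here \<open>k\<close> is the dyadic level. The number \<open>c\<close> is only an upper
  bound, so coincidences among refined cells need no exact counting.\<close>

definition cellwise :: "'a::real_vector set \<Rightarrow> nat \<Rightarrow> nat \<Rightarrow> 'a set \<Rightarrow> bool" where
  "cellwise P k c A \<longleftrightarrow> (\<exists>T. finite T \<and> card T \<le> c \<and> A \<subseteq> (\<Union>t\<in>T. homothet t ((1/2) ^ k) P))"

lemma cellwise_subset:
  assumes "cellwise P k c A" "B \<subseteq> A"
  shows "cellwise P k c B"
proof -
  obtain T where T: "finite T" "card T \<le> c" "A \<subseteq> (\<Union>t\<in>T. homothet t ((1/2) ^ k) P)"
    using assms(1) unfolding cellwise_def by blast
  have "B \<subseteq> (\<Union>t\<in>T. homothet t ((1/2) ^ k) P)" using assms(2) T(3) by (rule order_trans)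
  then show ?thesis unfolding cellwise_def using T(1,2) by (intro exI[of _ T]) simp
qed

lemma cellwise_Suc:
  assumes "cellwise P 1 n P" "cellwise P k c A"
  shows "cellwise P (Suc k) (c * n) A"
proof -
  obtain S where S: "finite S" "card S \<le> n" "P \<subseteq> (\<Union>s\<in>S. homothet s (1/2) P)"
    using assms(1) unfolding cellwise_def by auto
  obtain T where T: "finite T" "card T \<le> c" "A \<subseteq> (\<Union>t\<in>T. homothet t ((1/2) ^ k) P)"
    using assms(2) unfolding cellwise_def by auto
  let ?R = "(\<lambda>(t, s). t + (1/2) ^ k *\<^sub>R s) ` (T \<times> S)"
  have "homothet t ((1/2) ^ k) P \<subseteq> (\<Union>s\<in>S. homothet (t + (1/2) ^ k *\<^sub>R s) ((1/2) ^ Suc k) P)" for t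
    using homothet_mono[OF S(3), of t "(1/2) ^ k"] by (simp add: homothet_UN homothet_homothet mult.commute)
  then have "(\<Union>t\<in>T. homothet t ((1/2) ^ k) P) \<subseteq> (\<Union>t\<in>T. \<Union>s\<in>S. homothet (t + (1/2) ^ k *\<^sub>R s) ((1/2) ^ Suc k) P)"
    by (intro UN_mono) auto
  also have "\<dots> = (\<Union>t\<in>?R. homothet t ((1/2) ^ Suc k) P)" by auto
  finally have "A \<subseteq> (\<Union>t\<in>?R. homothet t ((1/2) ^ Suc k) P)" using T(3) by simp
  moreover have "card ?R \<le> c * n"
    using card_image_le[of "T \<times> S" "\<lambda>(t, s). t + (1/2) ^ k *\<^sub>R s"] S T mult_le_mono[OF T(2) S(2)]
    by (simp add: card_cartesian_product)
  ultimately show ?thesis unfolding cellwise_def using S(1) T(1)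
    by (intro exI[of _ ?R]) simp
qed

lemma cellwise_refine:
  assumes "cellwise P 1 n P" "cellwise P k c A" "k \<le> m"
  shows "cellwise P m (c * n ^ (m - k)) A"
  using \<open>k \<le> m\<close>
proof (induction m rule: dec_induct)
  case base then show ?case using assms by simp
next
  case (step m)
  then show ?case using cellwise_Suc[OF assms(1) step.IH] by (simp add: Suc_diff_le mult_ac)
qed

text \<open>Give a cell of level \<open>k\<close> the weight \<open>(1 / n) ^ k\<close>. The largest
  homothet fills one cell after all remaining cells are refined to its level. Refining keeps the
  bound on the total weight, and filling a cell takes the same weight from both sides, so nothing is
  wasted.\<close>

lemma dyadic_cells_cover:
  assumes P: "cellwise P 1 n P" and n: "n > 0"
  shows "finite J \<Longrightarrow> cellwise P m c A \<Longrightarrow> (\<And>i. i \<in> J \<Longrightarrow> m \<le> k i) \<Longrightarrow>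
    real c * (1 / real n) ^ m \<le> (\<Sum>i\<in>J. (1 / real n) ^ k i) \<Longrightarrow> covers_with J (\<lambda>i. (1/2) ^ k i) P A"
proof (induction J arbitrary: A m c rule: finite_psubset_induct)
  case (psubset J)
  note cell = psubset.prems(1) and mk = psubset.prems(2) and sum = psubset.prems(3)
  show ?case
  proof (cases "J = {}")
    case True
    moreover have "(1 / real n) ^ m > 0" using n by simp
    ultimately have "c = 0" using sum by (auto simp: mult_le_0_iff)
    then have "A = {}" using cell by (auto simp: cellwise_def)
    then show ?thesis by (simp add: covers_with_def)
  next
    case False
    define i where "i = arg_min_on k J"
    have i: "i \<in> J" "\<And>j. j \<in> J \<Longrightarrow> k i \<le> k j"
      using arg_min_if_finite[of J k] False psubset.hyps unfolding i_def by (auto simp: not_less)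
    define c' where "c' = c * n ^ (k i - m)"
    have "cellwise P (k i) c' A"
      unfolding c'_def using cellwise_refine[OF P cell mk[OF i(1)]] .
    then obtain T where T: "finite T" "card T \<le> c'" "A \<subseteq> (\<Union>t\<in>T. homothet t ((1/2) ^ k i) P)"
      unfolding cellwise_def by blast
    have c': "real c' * (1 / real n) ^ k i \<le> (\<Sum>i\<in>J. (1 / real n) ^ k i)"
    proof -
      have "(1 / real n) ^ k i = (1 / real n) ^ (k i - m) * (1 / real n) ^ m"
        using mk[OF i(1)] by (simp flip: power_add)
      then show ?thesis using sum n by (simp add: c'_def power_one_over)
    qed
    show ?thesis
    proof (cases "T = {}")
      case True
      then show ?thesis using T(3) by (simp add: covers_with_def)
    next
      case False
      then obtain t where t: "t \<in> T" by blast
      define A' where "A' = A - homothet t ((1/2) ^ k i) P"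
      have c1: "c' \<ge> 1" using T False by (metis One_nat_def Suc_leI card_gt_0_iff le_trans)
      have "covers_with (J - {i}) (\<lambda>i. (1/2) ^ k i) P A'"
      proof (rule psubset.IH)
        show "J - {i} \<subset> J" using i by blast
        show "cellwise P (k i) (c' - 1) A'"
          unfolding cellwise_def using T t by (intro exI[of _ "T - {t}"]) (auto simp: A'_def)
        show "k i \<le> k j" if "j \<in> J - {i}" for j using i that by blast
        show "real (c' - 1) * (1 / real n) ^ k i \<le> (\<Sum>i\<in>J - {i}. (1 / real n) ^ k i)"
          using c' c1 i(1) psubset.hyps by (simp add: sum_diff1 of_nat_diff algebra_simps)
      qed
      moreover have "covers_with {i} (\<lambda>i. (1/2) ^ k i) P (homothet t ((1/2) ^ k i) P)"
        unfolding covers_with_def by (intro exI[of _ "\<lambda>_. t"]) simp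
      ultimately have "covers_with ({i} \<union> (J - {i})) (\<lambda>i. (1/2) ^ k i) P (homothet t ((1/2) ^ k i) P \<union> A')"
        by (intro covers_with_Un) auto
      then show ?thesis by (rule covers_with_mono) (use i in \<open>auto simp: A'_def\<close>)
    qed
  qed
qed

text \<open>One corner is at the origin and the edges are \<open>c v b\<close>; the set
  \<open>Basis\<close> serves only to supply \<open>DIM('a)\<close> labels.\<close>

definition parallelotope :: "('a \<Rightarrow> 'a) \<Rightarrow> real \<Rightarrow> 'a::euclidean_space set" where
  "parallelotope v c = {(\<Sum>b\<in>Basis. a b *\<^sub>R v b) |a. \<forall>b\<in>Basis. 0 \<le> a b \<and> a b \<le> c}"

lemma parallelotopeI: "(\<And>b. b \<in> Basis \<Longrightarrow> 0 \<le> a b \<and> a b \<le> c) \<Longrightarrow> (\<Sum>b\<in>Basis. a b *\<^sub>R v b) \<in> parallelotope v c"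
  unfolding parallelotope_def by blast

lemma homothet_parallelotope:
  assumes "l > 0"
  shows "homothet 0 l (parallelotope v c) = parallelotope v (l * c)"
proof
  show "homothet 0 l (parallelotope v c) \<subseteq> parallelotope v (l * c)"
  proof
    fix x assume "x \<in> homothet 0 l (parallelotope v c)"
    then obtain a where a: "x = l *\<^sub>R (\<Sum>b\<in>Basis. a b *\<^sub>R v b)" "\<And>b. b \<in> Basis \<Longrightarrow> 0 \<le> a b \<and> a b \<le> c"
      unfolding parallelotope_def homothet_def by auto
    have "(\<Sum>b\<in>Basis. (l * a b) *\<^sub>R v b) \<in> parallelotope v (l * c)"
      using a(2) assms by (intro parallelotopeI) (auto intro: mult_left_mono)
    then show "x \<in> parallelotope v (l * c)" by (simp add: a scaleR_sum_right)
  qed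
  show "parallelotope v (l * c) \<subseteq> homothet 0 l (parallelotope v c)"
  proof
    fix x assume "x \<in> parallelotope v (l * c)"
    then obtain a where a: "x = (\<Sum>b\<in>Basis. a b *\<^sub>R v b)" "\<And>b. b \<in> Basis \<Longrightarrow> 0 \<le> a b \<and> a b \<le> l * c"
      unfolding parallelotope_def by blast
    have "(\<Sum>b\<in>Basis. (a b / l) *\<^sub>R v b) \<in> parallelotope v c"
      using a(2) assms by (intro parallelotopeI) (auto simp: field_simps)
    moreover have "x = 0 + l *\<^sub>R (\<Sum>b\<in>Basis. (a b / l) *\<^sub>R v b)"
      using assms by (simp add: a scaleR_sum_right)
    ultimately show "x \<in> homothet 0 l (parallelotope v c)" unfolding homothet_def by blast
  qed
qed

lemma cellwise_parallelotope:
  fixes v :: "'a \<Rightarrow> 'a::euclidean_space"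
  assumes "N > 0"
  shows "cellwise (parallelotope v 1) 0 (N ^ DIM('a)) (parallelotope v (real N))"
proof -
  let ?S = "Basis \<rightarrow>\<^sub>E {..<N} :: ('a \<Rightarrow> nat) set"
  define g where "g = (\<lambda>n::'a \<Rightarrow> nat. \<Sum>b\<in>Basis. real (n b) *\<^sub>R v b)"
  have fin: "finite ?S" by (intro finite_PiE) auto
  have "card (g ` ?S) \<le> N ^ DIM('a)"
    using card_image_le[OF fin, of g] by (simp add: card_PiE)
  moreover have "parallelotope v (real N) \<subseteq> (\<Union>t\<in>g ` ?S. homothet t ((1/2)^0) (parallelotope v 1))"
  proof
    fix x assume "x \<in> parallelotope v (real N)"
    then obtain a where a: "x = (\<Sum>b\<in>Basis. a b *\<^sub>R v b)" "\<And>b. b \<in> Basis \<Longrightarrow> 0 \<le> a b \<and> a b \<le> real N"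
      unfolding parallelotope_def by blast
    \<comment> \<open>The cap \<open>N - 1\<close> assigns the far face, where
      \<open>a b = N\<close>, to the last cell.\<close>
    define n where "n = restrict (\<lambda>b. min (nat \<lfloor>a b\<rfloor>) (N - 1)) Basis"
    have n: "0 \<le> a b - real (n b)" "a b - real (n b) \<le> 1" if "b \<in> Basis" for b
      using a(2)[OF that] that assms by (auto simp: n_def min_def; linarith)+
    have "n \<in> ?S" using assms by (auto simp: n_def)
    moreover have "(\<Sum>b\<in>Basis. (a b - real (n b)) *\<^sub>R v b) \<in> parallelotope v 1"
      using n by (intro parallelotopeI) auto
    moreover have "x = g n + (\<Sum>b\<in>Basis. (a b - real (n b)) *\<^sub>R v b)"
      by (simp add: a g_def sum.distrib[symmetric] scaleR_left_distrib[symmetric])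
    ultimately show "x \<in> (\<Union>t\<in>g ` ?S. homothet t ((1/2)^0) (parallelotope v 1))"
      unfolding homothet_def by auto
  qed
  ultimately show ?thesis unfolding cellwise_def using fin by blast
qed

lemma cellwise_translate:
  assumes "cellwise P k c A"
  shows "cellwise P k c (homothet q 1 A)"
proof -
  obtain T where T: "finite T" "card T \<le> c" "A \<subseteq> (\<Union>t\<in>T. homothet t ((1/2) ^ k) P)"
    using assms unfolding cellwise_def by blast
  have "homothet q 1 A \<subseteq> (\<Union>t\<in>T. homothet (q + t) ((1/2) ^ k) P)"
    using homothet_mono[OF T(3), of q 1] by (simp add: homothet_UN homothet_homothet)
  then have "homothet q 1 A \<subseteq> (\<Union>t\<in>(+) q ` T. homothet t ((1/2) ^ k) P)" by simp
  moreover have "card ((+) q ` T) \<le> c" using T(1,2) card_image_le le_trans by blast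
  ultimately show ?thesis unfolding cellwise_def using T(1) by (intro exI[of _ "(+) q ` T"]) simp
qed

text \<open>This is the splitting of the doubled parallelotope into unit cells, scaled by one
  half.\<close>

lemma cellwise_parallelotope_halves:
  fixes v :: "'a \<Rightarrow> 'a::euclidean_space"
  shows "cellwise (parallelotope v 1) 1 (2 ^ DIM('a)) (parallelotope v 1)"
proof -
  obtain T where T: "finite T" "card T \<le> 2 ^ DIM('a)"
    "parallelotope v 2 \<subseteq> (\<Union>t\<in>T. homothet t 1 (parallelotope v 1))"
    using cellwise_parallelotope[of 2 v] unfolding cellwise_def by auto
  have "parallelotope v 1 = homothet 0 (1/2) (parallelotope v 2)"
    by (simp add: homothet_parallelotope)
  also have "\<dots> \<subseteq> (\<Union>t\<in>T. homothet ((1/2) *\<^sub>R t) (1/2) (parallelotope v 1))"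
    using homothet_mono[OF T(3), of 0 "1/2"] by (simp add: homothet_UN homothet_homothet)
  also have "\<dots> = (\<Union>t\<in>(*\<^sub>R) (1/2) ` T. homothet t ((1/2)^1) (parallelotope v 1))" by simp
  finally show ?thesis
    unfolding cellwise_def using T(1,2) card_image_le[OF T(1), of "(*\<^sub>R) (1/2)"]
    by (intro exI[of _ "(*\<^sub>R) (1/2) ` T"]) auto
qed

text \<open>The first power of \<open>q\<close> not exceeding \<open>l\<close> has positive exponent
  because \<open>l < 1\<close>. Rounding a ratio down to it costs a factor below
  \<open>1 / q\<close>.\<close>

lemma exists_power_bracket:
  fixes q l :: real
  assumes "0 < q" "q < 1" "0 < l" "l < 1"
  shows "\<exists>k. q ^ Suc k \<le> l \<and> l < q ^ k"
proof -
  obtain k0 where "q ^ k0 < l" using real_arch_pow_inv[of l q] assms by auto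
  then have ex: "q ^ k0 \<le> l" by simp
  define k where "k = (LEAST k. q ^ k \<le> l)"
  have k: "q ^ k \<le> l" unfolding k_def using ex by (rule LeastI)
  have "k \<noteq> 0" using k assms by (intro notI) simp
  then obtain j where j: "k = Suc j" using not0_implies_Suc by blast
  have "\<not> q ^ j \<le> l" using not_less_Least[of j "\<lambda>k. q ^ k \<le> l"] j by (simp add: k_def)
  then have "q ^ Suc j \<le> l" "l < q ^ j" using k j by (simp_all add: not_le)
  then show ?thesis by blast
qed

text \<open>The outer parallelotope splits into \<open>N ^ DIM('a)\<close> unit cells, and by
  \<open>inner\<close> every homothet of \<open>K\<close> contains a cell of the same ratio.
  Rounding the ratios down to powers of \<open>1/2\<close> costs at most a further factor
  \<open>2 ^ DIM('a)\<close> in volume.\<close>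

theorem parallelotope_sandwich_cover:
  fixes K :: "'a::euclidean_space set"
  assumes K: "convex K" and inner: "homothet p 1 (parallelotope v 1) \<subseteq> K"
    and outer: "K \<subseteq> homothet q 1 (parallelotope v (real N))" and N: "N > 0"
    and J: "finite J" "\<And>i. i \<in> J \<Longrightarrow> l i > 0"
    and large: "real ((2 * N) ^ DIM('a)) \<le> (\<Sum>i\<in>J. l i ^ DIM('a))"
  shows "covers_with J l K K"
proof (cases "\<exists>i\<in>J. l i \<ge> 1")
  case True
  have "(\<Sum>b\<in>Basis. 0 *\<^sub>R v b) \<in> parallelotope v 1" by (intro parallelotopeI) auto
  then have ne: "K \<noteq> {}" using inner by (auto simp: homothet_def)
  obtain i where "i \<in> J" "l i \<ge> 1" using True by blast
  then show ?thesis by (rule covers_with_single[OF K ne])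
next
  case False
  define P where "P = parallelotope v 1"
  have "\<exists>k. (1/2) ^ k \<le> l i \<and> l i < 2 * (1/2) ^ k" if i: "i \<in> J" for i
  proof -
    have "l i < 1" using False i by (meson not_le)
    then obtain k where k: "(1/2) ^ Suc k \<le> l i" "l i < (1/2) ^ k"
      using exists_power_bracket[of "1/2" "l i"] J(2)[OF i] by auto
    have "(1/2) ^ k = 2 * (1/2::real) ^ Suc k" by simp
    with k show ?thesis by metis
  qed
  then obtain k where k: "\<forall>i\<in>J. (1/2) ^ k i \<le> l i \<and> l i < 2 * (1/2) ^ k i" by metis
  have halves: "cellwise P 1 (2 ^ DIM('a)) P" unfolding P_def by (rule cellwise_parallelotope_halves)
  have "cellwise P 0 (N ^ DIM('a)) (homothet q 1 (parallelotope v (real N)))"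
    unfolding P_def using cellwise_parallelotope[OF N] by (rule cellwise_translate)
  then have "cellwise P 0 (N ^ DIM('a)) K" by (rule cellwise_subset[OF _ outer])
  moreover have "real (N ^ DIM('a)) * (1 / real (2 ^ DIM('a))) ^ 0 \<le> (\<Sum>i\<in>J. (1 / real (2 ^ DIM('a))) ^ k i)"
  proof -
    have "2 ^ DIM('a) * real (N ^ DIM('a)) \<le> (\<Sum>i\<in>J. l i ^ DIM('a))"
      using large by (simp add: power_mult_distrib)
    also have "\<dots> \<le> (\<Sum>i\<in>J. (2 * (1/2) ^ k i) ^ DIM('a))"
      using k J(2) by (intro sum_mono power_mono) (auto simp: less_imp_le)
    also have "\<dots> = 2 ^ DIM('a) * (\<Sum>i\<in>J. (1 / real (2 ^ DIM('a))) ^ k i)"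
    proof -
      have "((1/2::real) ^ n) ^ DIM('a) = (1 / real (2 ^ DIM('a))) ^ n" for n
        by (simp add: power_one_over) (simp add: mult.commute flip: power_mult)
      then show ?thesis by (simp only: sum_distrib_left power_mult_distrib)
    qed
    finally show ?thesis by simp
  qed
  ultimately have "covers_with J (\<lambda>i. (1/2) ^ k i) P K"
    using dyadic_cells_cover[OF halves _ J(1), of 0 "N ^ DIM('a)" K k] by simp
  then have cov: "covers_with J (\<lambda>i. (1/2) ^ k i) K K"
  proof (rule covers_with_replace)
    fix i and t :: 'a
    have "homothet t ((1/2) ^ k i) P = homothet (t - (1/2) ^ k i *\<^sub>R p) ((1/2) ^ k i) (homothet p 1 P)"
      by (simp add: homothet_homothet)
    also have "\<dots> \<subseteq> homothet (t - (1/2) ^ k i *\<^sub>R p) ((1/2) ^ k i) K"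
      using inner unfolding P_def by (rule homothet_mono)
    finally show "\<exists>t'. homothet t ((1/2) ^ k i) P \<subseteq> homothet t' ((1/2) ^ k i) K" by blast
  qed
  have "(\<Sum>b\<in>Basis. 0 *\<^sub>R v b) \<in> parallelotope v 1" by (intro parallelotopeI) auto
  then have "K \<noteq> {}" using inner by (auto simp: homothet_def)
  moreover have "0 < (1/2::real) ^ k i \<and> (1/2) ^ k i \<le> l i" if "i \<in> J" for i using k that by simp
  ultimately show ?thesis by (rule covers_with_enlarge[OF cov K])
qed

section \<open>Convex bodies between parallelotopes\<close>

text \<open>A density below \<open>\<theta> < 1\<close> would cover the unit ball by copies of small
  ratio \<open>l\<close> with total volume at most \<open>\<theta>\<close> times that of a ball of
  radius \<open>1 + 2 * l * R\<close>. Letting \<open>l\<close> tend to zero contradicts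
  subadditivity of volume.\<close>

lemma one_le_density:
  fixes K :: "'a::euclidean_space set"
  assumes K: "compact K" "emeasure lebesgue K = 1"
  shows "1 \<le> translative_covering_density K"
proof (rule ccontr)
  assume "\<not> ?thesis"
  then obtain e where e: "translative_covering_density K < e" "e < 1"
    using dense[of "translative_covering_density K" 1] by (auto simp: not_le)
  then obtain \<theta> where \<theta>: "e = ennreal \<theta>" "0 \<le> \<theta>" by (cases e) auto
  have "\<theta> < 1" using e \<theta> by (simp add: ennreal_less_one_iff)
  have econ: "economical \<theta> K" using economical_if_density_less[OF K] e \<theta> by simp
  obtain R where R: "R > 0" "\<And>k. k \<in> K \<Longrightarrow> norm k \<le> R"
    using compact_imp_bounded[OF K(1)] bounded_pos by blast
  define d where "d = DIM('a)"
  define \<beta> where "\<beta> = measure lebesgue (cball (0::'a) 1)"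
  have \<beta>: "\<beta> > 0" using content_cball_pos[of 1 "0::'a"] by (simp add: \<beta>_def)
  have "1 \<le> \<theta> * (1 + 2 * l * R) ^ d" if l: "l > 0" for l
  proof -
    \<comment> \<open>The factor \<open>2\<close> provides the strict inequality needed for an open
      window.\<close>
    have "x - l *\<^sub>R k \<in> ball 0 (1 + 2 * l * R)" if "x \<in> cball 0 1" "k \<in> K" for x k :: 'a
    proof -
      have "norm (x - l *\<^sub>R k) \<le> norm x + l * norm k"
        using norm_triangle_ineq4[of x "l *\<^sub>R k"] l by simp
      also have "\<dots> \<le> 1 + l * R" using that R(2)[OF that(2)] l by (intro add_mono mult_left_mono) auto
      also have "\<dots> < 1 + 2 * l * R" using l R(1) by simp
      finally show ?thesis by simp
    qed
    from economicalD[OF econ open_ball bounded_ball l this]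
    obtain Y where Y: "finite Y" "cball 0 1 \<subseteq> (\<Union>y\<in>Y. homothet y l K)"
      "real (card Y) * l ^ d \<le> \<theta> * measure lebesgue (ball (0::'a) (1 + 2 * l * R))"
      unfolding d_def by blast
    have cm: "homothet y l K \<in> lmeasurable" for y
      unfolding homothet_def using K by (intro lmeasurable_compact compact_affinity)
    have K1: "measure lebesgue K = 1" using K(2) by (simp add: measure_def)
    have "\<beta> \<le> measure lebesgue (\<Union>y\<in>Y. homothet y l K)"
      unfolding \<beta>_def using Y cm by (intro measure_mono_fmeasurable) (auto intro!: fmeasurable.finite_UN)
    also have "\<dots> \<le> (\<Sum>y\<in>Y. measure lebesgue (homothet y l K))"
      using Y(1) cm by (intro measure_UNION_le) (auto dest: fmeasurableD)
    also have "\<dots> = real (card Y) * l ^ d" using l K1 by (simp add: measure_homothet d_def)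
    also have "\<dots> \<le> \<theta> * measure lebesgue (cball (0::'a) (1 + 2 * l * R))"
      using Y(3) content_cball_conv_ball[of "0::'a"] by simp
    also have "\<dots> = \<theta> * ((1 + 2 * l * R) ^ d * \<beta>)"
      unfolding \<beta>_def d_def using l R(1) by (subst measure_cball_conv_unit) auto
    finally show ?thesis using \<beta> by simp
  qed
  then have "\<forall>\<^sub>F l in at_right 0. 1 \<le> \<theta> * (1 + 2 * l * R) ^ d"
    by (auto simp: eventually_at_filter)
  moreover have "((\<lambda>l. \<theta> * (1 + 2 * l * R) ^ d) \<longlongrightarrow> \<theta> * (1 + 2 * 0 * R) ^ d) (at_right 0)"
    by (intro tendsto_intros)
  ultimately have "1 \<le> \<theta> * (1 + 2 * 0 * R) ^ d"
    by (intro tendsto_lowerbound[of _ _ "at_right 0"]) auto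
  then show False using \<open>\<theta> < 1\<close> by simp
qed

text \<open>A small cube at an interior point and a large cube around \<open>K\<close> suffice.
  There is no control over \<open>N\<close>, which is enough when the total volume is
  infinite.\<close>

lemma convex_body_sandwich:
  fixes K :: "'a::euclidean_space set"
  assumes "convex_body K"
  obtains p q v N where "N > 0" "homothet p 1 (parallelotope v 1) \<subseteq> K"
    "K \<subseteq> homothet q 1 (parallelotope v (real N))"
proof -
  have K: "compact K" "interior K \<noteq> {}" using assms by (auto simp: convex_body_def)
  then obtain z e where e: "e > 0" "cball z e \<subseteq> K" by (meson ex_in_conv mem_interior_cball)
  obtain R where R: "R > 0" "\<And>k. k \<in> K \<Longrightarrow> norm k \<le> R"
    using compact_imp_bounded[OF K(1)] bounded_pos by blast
  \<comment> \<open>With this edge length, \<open>DIM('a)\<close> edges add up to norm at most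
    \<open>e\<close>.\<close>
  define s where "s = e / DIM('a)"
  have s: "s > 0" using e by (simp add: s_def)
  define v where "v = (\<lambda>b::'a. s *\<^sub>R b)"
  obtain N where N: "2 * R / s \<le> real N" using real_arch_simple by blast
  have "0 < 2 * R / s" using R s by simp
  then have N0: "N > 0" using N by (intro gr0I) auto
  have inner: "homothet z 1 (parallelotope v 1) \<subseteq> K"
  proof
    fix x assume "x \<in> homothet z 1 (parallelotope v 1)"
    then obtain a where a: "x = z + (\<Sum>b\<in>Basis. a b *\<^sub>R v b)" "\<And>b. b \<in> Basis \<Longrightarrow> 0 \<le> a b \<and> a b \<le> 1"
      unfolding homothet_def parallelotope_def by auto
    have "norm (\<Sum>b\<in>Basis. a b *\<^sub>R v b) \<le> (\<Sum>b\<in>(Basis::'a set). s)"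
      using a(2) s by (intro sum_norm_le) (auto simp: v_def abs_mult mult_le_cancel_right1)
    also have "\<dots> = e" by (simp add: s_def)
    finally show "x \<in> K" using e(2) a(1) by (auto simp: dist_norm)
  qed
  have outer: "K \<subseteq> homothet (- (\<Sum>b\<in>Basis. R *\<^sub>R b)) 1 (parallelotope v (real N))"
  proof
    fix x assume x: "x \<in> K"
    have "(\<Sum>b\<in>Basis. ((x \<bullet> b + R) / s) *\<^sub>R v b) \<in> parallelotope v (real N)"
    proof (rule parallelotopeI)
      fix b :: 'a assume "b \<in> Basis"
      then have "\<bar>x \<bullet> b\<bar> \<le> R" using R(2)[OF x] Basis_le_norm[of b x] by linarith
      then have "0 \<le> x \<bullet> b + R" "x \<bullet> b + R \<le> 2 * R" by linarith+
      then have "0 \<le> (x \<bullet> b + R) / s" "(x \<bullet> b + R) / s \<le> 2 * R / s"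
        using s by (auto intro: divide_right_mono)
      then show "0 \<le> (x \<bullet> b + R) / s \<and> (x \<bullet> b + R) / s \<le> real N" using N by linarith
    qed
    moreover have "(\<Sum>b\<in>Basis. ((x \<bullet> b + R) / s) *\<^sub>R v b) = x + (\<Sum>b\<in>Basis. R *\<^sub>R b)"
      using s by (simp add: v_def scaleR_left_distrib sum.distrib euclidean_representation)
    ultimately show "x \<in> homothet (- (\<Sum>b\<in>Basis. R *\<^sub>R b)) 1 (parallelotope v (real N))"
      unfolding homothet_def by (intro image_eqI[of _ _ "x + (\<Sum>b\<in>Basis. R *\<^sub>R b)"]) auto
  qed
  show ?thesis by (rule that[OF N0 inner outer])
qed

text \<open>In dimension one a convex body is a segment, itself a parallelotope.\<close>

lemma linear_convex_body_sandwich: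
  fixes K :: "'a::euclidean_space set"
  assumes "convex_body K" "DIM('a) = 1"
  obtains p q v where "homothet p 1 (parallelotope v 1) \<subseteq> K" "K \<subseteq> homothet q 1 (parallelotope v (real 1))"
proof -
  have K: "compact K" "convex K" "interior K \<noteq> {}" using assms by (auto simp: convex_body_def)
  obtain e :: 'a where e: "Basis = {e}" using assms(2) card_1_singletonE by blast
  have ne: "K \<noteq> {}" using K(3) by auto
  have cont: "continuous_on K (\<lambda>x. x \<bullet> e)" by (intro continuous_intros)
  obtain u where u: "u \<in> K" "\<And>x. x \<in> K \<Longrightarrow> x \<bullet> e \<le> u \<bullet> e"
    using continuous_attains_sup[OF K(1) ne cont] by blast
  obtain w where w: "w \<in> K" "\<And>x. x \<in> K \<Longrightarrow> w \<bullet> e \<le> x \<bullet> e"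
    using continuous_attains_inf[OF K(1) ne cont] by blast
  have sum: "(\<Sum>b\<in>Basis. a b *\<^sub>R v b) = a e *\<^sub>R v e" for a and v :: "'a \<Rightarrow> 'a" by (simp add: e)
  have inner: "homothet w 1 (parallelotope (\<lambda>_. u - w) 1) \<subseteq> K"
  proof
    fix x assume "x \<in> homothet w 1 (parallelotope (\<lambda>_. u - w) 1)"
    then obtain a where a: "x = w + a e *\<^sub>R (u - w)" "0 \<le> a e" "a e \<le> 1"
      unfolding homothet_def parallelotope_def sum by (auto simp: e)
    have "x = a e *\<^sub>R u + (1 - a e) *\<^sub>R w" by (simp add: a algebra_simps)
    then show "x \<in> K" using convexD[OF K(2) u(1) w(1), of "a e" "1 - a e"] a by simp
  qed
  have outer: "K \<subseteq> homothet w 1 (parallelotope (\<lambda>_. u - w) (real 1))"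
  proof
    fix x assume x: "x \<in> K"
    \<comment> \<open>If the end points had equal coordinates, division by zero would give
      \<open>a = 0\<close>, which is then the right coefficient.\<close>
    define a where "a = (x \<bullet> e - w \<bullet> e) / (u \<bullet> e - w \<bullet> e)"
    have "0 \<le> a" "a \<le> 1"
      unfolding a_def using u(2)[OF x] w(2)[OF x] by (auto simp: divide_le_eq_1)
    then have "(\<Sum>b\<in>(Basis::'a set). a *\<^sub>R (u - w)) \<in> parallelotope (\<lambda>_. u - w) (real 1)"
      by (intro parallelotopeI) auto
    moreover have "x = w + a *\<^sub>R (u - w)"
    proof (rule euclidean_eqI)
      fix b :: 'a assume "b \<in> Basis"
      then show "x \<bullet> b = (w + a *\<^sub>R (u - w)) \<bullet> b"
        using u(2)[OF x] w(2)[OF x] by (cases "u \<bullet> e = w \<bullet> e") (auto simp: e a_def inner_add_left inner_diff_left)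
    qed
    ultimately show "x \<in> homothet w 1 (parallelotope (\<lambda>_. u - w) (real 1))"
      by (auto simp: homothet_def e)
  qed
  show ?thesis by (rule that[OF inner outer])
qed

text \<open>Taking \<^term>\<open>u\<close> and \<^term>\<open>v\<close> to maximise the area of the triangle \<open>w u v\<close> bounds the
  coordinates, which Cramer's rule expresses as ratios of areas.\<close>

lemma planar_coordinates:
  fixes K :: "'a::euclidean_space set"
  assumes K: "convex_body K" and dim: "DIM('a) = 2" and w: "w \<in> K"
  shows "\<exists>u\<in>K. \<exists>v\<in>K. \<forall>x\<in>K.
    \<exists>a b. \<bar>a\<bar> \<le> 1 \<and> \<bar>b\<bar> \<le> 1 \<and> x = w + a *\<^sub>R (u - w) + b *\<^sub>R (v - w)"
proof -
  have cK: "compact K" "interior K \<noteq> {}" using K by (auto simp: convex_body_def)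
  obtain e f :: 'a where B: "Basis = {e, f}" "e \<noteq> f" using dim by (metis card_2_iff)
  have ef: "e \<bullet> e = 1" "f \<bullet> f = 1" "e \<bullet> f = 0" "f \<bullet> e = 0"
  proof -
    have "e \<in> Basis" "f \<in> Basis" unfolding B by auto
    then show "e \<bullet> e = 1" "f \<bullet> f = 1" "e \<bullet> f = 0" "f \<bullet> e = 0"
      using B(2) by (simp_all add: inner_Basis)
  qed
  \<comment> \<open>The determinant in the coordinates \<open>e\<close>, \<open>f\<close>: twice the
    signed area of the triangle spanned by \<open>p\<close> and \<open>q\<close>.\<close>
  define D where "D p q = (p \<bullet> e) * (q \<bullet> f) - (p \<bullet> f) * (q \<bullet> e)" for p q :: 'a
  have "continuous_on (K \<times> K) (\<lambda>z. \<bar>D (fst z - w) (snd z - w)\<bar>)"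
    unfolding D_def by (intro continuous_intros)
  then obtain z where z: "z \<in> K \<times> K"
    "\<And>y. y \<in> K \<times> K \<Longrightarrow> \<bar>D (fst y - w) (snd y - w)\<bar> \<le> \<bar>D (fst z - w) (snd z - w)\<bar>"
    using continuous_attains_sup[of "K \<times> K" "\<lambda>z. \<bar>D (fst z - w) (snd z - w)\<bar>"] cK w compact_Times by blast
  obtain u v where uv: "z = (u, v)" by (cases z) auto
  then have uvK: "u \<in> K" "v \<in> K" using z by auto
  define \<Delta> where "\<Delta> = D (u - w) (v - w)"
  have max: "\<bar>D (x - w) (y - w)\<bar> \<le> \<bar>\<Delta>\<bar>" if "x \<in> K" "y \<in> K" for x y
    using z(2)[of "(x, y)"] that uv by (simp add: \<Delta>_def)
  have "\<Delta> \<noteq> 0"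
  proof
    assume "\<Delta> = 0"
    then have zero: "D (x - w) (y - w) = 0" if "x \<in> K" "y \<in> K" for x y using max[OF that] by simp
    obtain c r where r: "r > 0" "cball c r \<subseteq> K" using cK(2) by (meson ex_in_conv mem_interior_cball)
    have mem: "c \<in> K" "c + r *\<^sub>R e \<in> K" "c + r *\<^sub>R f \<in> K"
      using r(1) by (auto intro!: subsetD[OF r(2)] simp: dist_norm norm_eq_sqrt_inner ef)
    \<comment> \<open>By bilinearity this mixed difference isolates the determinant of
      \<open>r e\<close> and \<open>r f\<close>; it would vanish if all four areas did.\<close>
    have "D (c + r *\<^sub>R e - w) (c + r *\<^sub>R f - w) - D (c + r *\<^sub>R e - w) (c - w)
        - D (c - w) (c + r *\<^sub>R f - w) + D (c - w) (c - w) = r * r"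
      by (simp add: D_def ef inner_add_left inner_diff_left algebra_simps)
    then show False using zero mem r(1) by simp
  qed
  have "\<exists>a b. \<bar>a\<bar> \<le> 1 \<and> \<bar>b\<bar> \<le> 1 \<and> x = w + a *\<^sub>R (u - w) + b *\<^sub>R (v - w)" if x: "x \<in> K" for x
  proof (intro exI conjI)
    show "\<bar>D (x - w) (v - w) / \<Delta>\<bar> \<le> 1" "\<bar>D (u - w) (x - w) / \<Delta>\<bar> \<le> 1"
      using max[OF x uvK(2)] max[OF uvK(1) x] \<open>\<Delta> \<noteq> 0\<close> by (auto simp: divide_le_eq_1)
    have "\<Delta> *\<^sub>R (x - w) = D (x - w) (v - w) *\<^sub>R (u - w) + D (u - w) (x - w) *\<^sub>R (v - w)"
    proof (rule euclidean_eqI)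
      fix b :: 'a assume "b \<in> Basis"
      then consider "b = e" | "b = f" using B by blast
      then show "(\<Delta> *\<^sub>R (x - w)) \<bullet> b = (D (x - w) (v - w) *\<^sub>R (u - w) + D (u - w) (x - w) *\<^sub>R (v - w)) \<bullet> b"
        by cases (simp_all add: \<Delta>_def D_def inner_add_left algebra_simps)
    qed
    then have "(1 / \<Delta>) *\<^sub>R (\<Delta> *\<^sub>R (x - w)) = (1 / \<Delta>) *\<^sub>R (D (x - w) (v - w) *\<^sub>R (u - w) + D (u - w) (x - w) *\<^sub>R (v - w))"
      by simp
    then show "x = w + (D (x - w) (v - w) / \<Delta>) *\<^sub>R (u - w) + (D (u - w) (x - w) / \<Delta>) *\<^sub>R (v - w)"
      using \<open>\<Delta> \<noteq> 0\<close> by (simp add: scaleR_add_right algebra_simps)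
  qed
  then show ?thesis using uvK by blast
qed

text \<open>The triangle \<open>w u v\<close> contains the parallelogram at \<open>w\<close> whose
  edges are half of \<open>u - w\<close> and \<open>v - w\<close>. Coordinates of points of
  \<open>K\<close> range from \<open>-1\<close> to \<open>1\<close>, which is four half
  edges.\<close>

lemma planar_convex_body_sandwich:
  fixes K :: "'a::euclidean_space set"
  assumes K: "convex_body K" and dim: "DIM('a) = 2"
  obtains p q v where "homothet p 1 (parallelotope v 1) \<subseteq> K" "K \<subseteq> homothet q 1 (parallelotope v (real 4))"
proof -
  have cK: "convex K" "interior K \<noteq> {}" using K by (auto simp: convex_body_def)
  obtain e f :: 'a where B: "Basis = {e, f}" "e \<noteq> f" using dim by (metis card_2_iff)
  obtain w where w: "w \<in> K" using cK(2) interior_subset by blast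
  obtain u v where uv: "u \<in> K" "v \<in> K" "\<And>x. x \<in> K \<Longrightarrow>
      \<exists>a b. \<bar>a\<bar> \<le> 1 \<and> \<bar>b\<bar> \<le> 1 \<and> x = w + a *\<^sub>R (u - w) + b *\<^sub>R (v - w)"
    using planar_coordinates[OF K dim w] by blast
  define g where "g = (\<lambda>b. (1/2) *\<^sub>R (if b = e then u - w else v - w))"
  have sum: "(\<Sum>b\<in>Basis. a b *\<^sub>R g b) = (a e / 2) *\<^sub>R (u - w) + (a f / 2) *\<^sub>R (v - w)" for a
    unfolding B(1) using B(2) by (auto simp: g_def)
  have inner: "homothet w 1 (parallelotope g 1) \<subseteq> K"
  proof
    fix x assume "x \<in> homothet w 1 (parallelotope g 1)"
    then obtain a where a: "x = w + ((a e / 2) *\<^sub>R (u - w) + (a f / 2) *\<^sub>R (v - w))"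
      "0 \<le> a e" "a e \<le> 1" "0 \<le> a f" "a f \<le> 1"
      unfolding homothet_def parallelotope_def sum by (auto simp: B)
    have "(1/2) *\<^sub>R (a e *\<^sub>R u + (1 - a e) *\<^sub>R w) + (1/2) *\<^sub>R (a f *\<^sub>R v + (1 - a f) *\<^sub>R w) \<in> K"
      using a uv w by (intro convexD[OF cK(1)]) auto
    moreover have "w = (1/2) *\<^sub>R w + (1/2) *\<^sub>R w" by (simp flip: scaleR_left_distrib)
    then have "x = (1/2) *\<^sub>R (a e *\<^sub>R u + (1 - a e) *\<^sub>R w) + (1/2) *\<^sub>R (a f *\<^sub>R v + (1 - a f) *\<^sub>R w)"
      unfolding a by (simp add: algebra_simps)
    ultimately show "x \<in> K" by simp
  qed
  have outer: "K \<subseteq> homothet (w - (u - w) - (v - w)) 1 (parallelotope g (real 4))"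
  proof
    fix x assume "x \<in> K"
    then obtain a b where ab: "\<bar>a\<bar> \<le> 1" "\<bar>b\<bar> \<le> 1" "x = w + a *\<^sub>R (u - w) + b *\<^sub>R (v - w)" using uv(3) by blast
    define c where "c = (\<lambda>i. 2 * (if i = e then a + 1 else b + 1))"
    have "(\<Sum>b\<in>Basis. c b *\<^sub>R g b) \<in> parallelotope g (real 4)"
      using ab by (intro parallelotopeI) (auto simp: c_def)
    moreover have "x = (w - (u - w) - (v - w)) + 1 *\<^sub>R (\<Sum>b\<in>Basis. c b *\<^sub>R g b)"
    proof -
      have c2: "c e / 2 = a + 1" "c f / 2 = b + 1" using B(2) by (simp_all add: c_def)
      show ?thesis unfolding sum c2 by (simp add: ab scaleR_left_distrib)
    qed
    ultimately show "x \<in> homothet (w - (u - w) - (v - w)) 1 (parallelotope g (real 4))"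
      unfolding homothet_def by (rule image_eqI[rotated])
  qed
  show ?thesis by (rule that[OF inner outer])
qed

text \<open>With the origin as \<open>w\<close>, all \<open>a u + b v\<close> with coefficients
  between \<open>-1/2\<close> and \<open>1/2\<close> are midpoints of points of \<open>K\<close>.
  Coordinates in \<open>K\<close> range from \<open>-1\<close> to \<open>1\<close>, so doubling the
  edges suffices.\<close>

lemma planar_symmetric_convex_body_sandwich:
  fixes K :: "'a::euclidean_space set"
  assumes K: "convex_body K" and sym: "uminus ` K = K" and dim: "DIM('a) = 2"
  obtains p q v where "homothet p 1 (parallelotope v 1) \<subseteq> K" "K \<subseteq> homothet q 1 (parallelotope v (real 2))"
proof -
  have cK: "convex K" "interior K \<noteq> {}" using K by (auto simp: convex_body_def)
  obtain e f :: 'a where B: "Basis = {e, f}" "e \<noteq> f" using dim by (metis card_2_iff)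
  have neg: "- x \<in> K" if "x \<in> K" for x using that sym by blast
  obtain k where "k \<in> K" using cK(2) interior_subset by blast
  then have w: "0 \<in> K" using convexD[OF cK(1) _ neg, of k k "1/2" "1/2"] by simp
  obtain u v where uv: "u \<in> K" "v \<in> K" "\<And>x. x \<in> K \<Longrightarrow>
      \<exists>a b. \<bar>a\<bar> \<le> 1 \<and> \<bar>b\<bar> \<le> 1 \<and> x = 0 + a *\<^sub>R (u - 0) + b *\<^sub>R (v - 0)"
    using planar_coordinates[OF K dim w] by blast
  define g where "g = (\<lambda>b. if b = e then u else v)"
  have sum: "(\<Sum>b\<in>Basis. a b *\<^sub>R g b) = a e *\<^sub>R u + a f *\<^sub>R v" for a
    unfolding B(1) using B(2) by (auto simp: g_def)
  have seg: "c *\<^sub>R x \<in> K" if "x \<in> K" "\<bar>c\<bar> \<le> 1" for c x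
  proof -
    have "((1 + c) / 2) *\<^sub>R x + ((1 - c) / 2) *\<^sub>R (- x) \<in> K"
      using that neg by (intro convexD[OF cK(1)]) (auto simp: field_simps)
    moreover have "((1 + c) / 2) *\<^sub>R x + ((1 - c) / 2) *\<^sub>R (- x) = ((1 + c) / 2 - (1 - c) / 2) *\<^sub>R x"
      by (simp add: scaleR_left_diff_distrib)
    moreover have "(1 + c) / 2 - (1 - c) / 2 = c" by (simp add: field_simps)
    ultimately show ?thesis by simp
  qed
  have inner: "homothet (- (1/2) *\<^sub>R (u + v)) 1 (parallelotope g 1) \<subseteq> K"
  proof
    fix x assume "x \<in> homothet (- (1/2) *\<^sub>R (u + v)) 1 (parallelotope g 1)"
    then obtain a where a: "x = - (1/2) *\<^sub>R (u + v) + (a e *\<^sub>R u + a f *\<^sub>R v)"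
      "0 \<le> a e" "a e \<le> 1" "0 \<le> a f" "a f \<le> 1"
      unfolding homothet_def parallelotope_def sum by (auto simp: B)
    have "(1/2) *\<^sub>R ((2 * a e - 1) *\<^sub>R u) + (1/2) *\<^sub>R ((2 * a f - 1) *\<^sub>R v) \<in> K"
      using a uv by (intro convexD[OF cK(1)] seg) auto
    moreover have "x = (1/2) *\<^sub>R ((2 * a e - 1) *\<^sub>R u) + (1/2) *\<^sub>R ((2 * a f - 1) *\<^sub>R v)"
      unfolding a by (simp add: scaleR_add_right scaleR_left_diff_distrib algebra_simps)
    ultimately show "x \<in> K" by simp
  qed
  have outer: "K \<subseteq> homothet (- (u + v)) 1 (parallelotope g (real 2))"
  proof
    fix x assume "x \<in> K"
    then obtain a b where ab': "\<bar>a\<bar> \<le> 1 \<and> \<bar>b\<bar> \<le> 1 \<and> x = 0 + a *\<^sub>R (u - 0) + b *\<^sub>R (v - 0)"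
      using uv(3) by blast
    then have ab: "\<bar>a\<bar> \<le> 1" "\<bar>b\<bar> \<le> 1" "x = a *\<^sub>R u + b *\<^sub>R v" by auto
    define c where "c = (\<lambda>i. if i = e then a + 1 else b + 1)"
    have "(\<Sum>b\<in>Basis. c b *\<^sub>R g b) \<in> parallelotope g (real 2)"
      using ab by (intro parallelotopeI) (auto simp: c_def)
    moreover have "x = - (u + v) + 1 *\<^sub>R (\<Sum>b\<in>Basis. c b *\<^sub>R g b)"
      unfolding sum using B(2) by (simp add: c_def ab scaleR_left_distrib)
    ultimately show "x \<in> homothet (- (u + v)) 1 (parallelotope g (real 2))"
      unfolding homothet_def by (rule image_eqI[rotated])
  qed
  show ?thesis by (rule that[OF inner outer])
qed

section \<open>The Rogers--Shephard inequality\<close>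

text \<open>Gamma at integers turns the left side into a quotient of factorials. This is where the
  binomial coefficient of the Rogers-Shephard bound comes from.\<close>

lemma Beta_nat_choose:
  assumes "d > 0"
  shows "real d * Beta (real d + 1) (real d) = 1 / real ((2 * d) choose d)"
proof -
  obtain m where m: "d = Suc m" using assms gr0_implies_Suc by blast
  have "Gamma (real d + 1) = fact d" using Gamma_fact[of d, where 'a=real] by (simp add: add.commute)
  moreover have "Gamma (real d) = fact m" using Gamma_fact[of m, where 'a=real] by (simp add: m add.commute)
  moreover have "Gamma (real d + 1 + real d) = fact (2 * d)"
    using Gamma_fact[of "2 * d", where 'a=real] by (simp add: algebra_simps)
  ultimately have "real d * Beta (real d + 1) (real d) = fact d * (real d * fact m) / fact (2 * d)"
    unfolding Beta_def by simp
  also have "real d * fact m = fact d" by (simp add: m)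
  also have "fact d * fact d / fact (2 * d) = 1 / real ((2 * d) choose d)"
    using binomial_fact[of d "2 * d", where 'a=real] by simp
  finally show ?thesis .
qed

lemma nn_integral_Beta_choose:
  assumes "d > 0"
  shows "(\<integral>\<^sup>+\<theta>. ennreal (real d * (1 - \<theta>) ^ (d - 1) * \<theta> ^ d) * indicator {0..1} \<theta> \<partial>lborel)
    = ennreal (1 / real ((2 * d) choose d))"
proof -
  have "((\<lambda>t. t powr (real d + 1 - 1) * (1 - t) powr (real d - 1)) has_integral Beta (real d + 1) (real d)) {0..1}"
    using assms by (intro has_integral_Beta_real) auto
  \<comment> \<open>At the end points \<open>powr\<close> and \<open>^\<close> may disagree, since
    \<open>0 powr 0 = 0\<close>; the open interval avoids them.\<close>
  then have "((\<lambda>t. t ^ d * (1 - t) ^ (d - 1)) has_integral Beta (real d + 1) (real d)) {0<..<1}"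
    unfolding has_integral_Icc_iff_Ioo
    by (rule has_integral_eq[rotated])
       (use assms in \<open>auto simp: powr_realpow of_nat_diff simp flip: powr_realpow\<close>)
  then have "((\<lambda>t. real d * (t ^ d * (1 - t) ^ (d - 1))) has_integral (real d * Beta (real d + 1) (real d))) {0..1}"
    unfolding has_integral_Icc_iff_Ioo by (rule has_integral_mult_right)
  then have *: "((\<lambda>t. real d * (1 - t) ^ (d - 1) * t ^ d) has_integral (1 / real ((2 * d) choose d))) {0..1}"
    unfolding Beta_nat_choose[OF assms] by (simp add: mult_ac)
  show ?thesis
    by (rule nn_integral_has_integral_lebesgue'[OF _ *]) simp
qed

text \<open>Both sides integrate \<^term>\<open>\<lambda>x. emeasure lborel (K \<inter> (+) x ` K)\<close>: the integral is one, while at a point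
  of \<open>\<theta> (K - K)\<close> the integrand is at least \<^term>\<open>(1 - \<theta>) ^ d\<close> because the intersection contains a
  homothet of \<^term>\<open>K\<close> of ratio \<^term>\<open>1 - \<theta>\<close>.\<close>

theorem rogers_shephard:
  fixes K :: "'a::euclidean_space set"
  assumes K: "compact K" "convex K" "emeasure lebesgue K = 1"
  shows "measure lebesgue {x - y |x y. x \<in> K \<and> y \<in> K} \<le> real ((2 * DIM('a)) choose DIM('a))"
proof -
  define d where "d = DIM('a)"
  have d: "d > 0" by (simp add: d_def)
  define D where "D = {x - y |x y. x \<in> K \<and> y \<in> K}"
  have D: "compact D" unfolding D_def using K by (intro compact_differences)
  have K1: "emeasure lborel K = 1" using K by (simp add: compact_imp_closed borel_closed)
  have Km[measurable]: "K \<in> sets borel" using K by (simp add: compact_imp_closed borel_closed)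
  define f where "f x = emeasure lborel (K \<inter> (+) x ` K)" for x
  have tr: "y \<in> (+) x ` K \<longleftrightarrow> y - x \<in> K" for x y
    by (metis add_diff_cancel_left' diff_add_cancel image_iff add.commute)
  have refl: "emeasure lborel {x. y - x \<in> K} = 1" for y
  proof -
    have "{x. y - x \<in> K} = (\<lambda>z. -1 *\<^sub>R z + y) ` K"
    proof safe
      fix x assume "y - x \<in> K" then show "x \<in> (\<lambda>z. -1 *\<^sub>R z + y) ` K" by (intro image_eqI[of _ _ "y - x"]) auto
    qed auto
    moreover have "{x. y - x \<in> K} \<in> sets borel" by measurable
    ultimately show ?thesis using emeasure_lebesgue_affine[of "-1" y K] K by simp
  qed
  \<comment> \<open>Fubini for the pairs with \<open>y \<in> K\<close> and
    \<open>y - x \<in> K\<close> yields the square of the volume of \<open>K\<close>.\<close>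
  have intf: "(\<integral>\<^sup>+x. f x \<partial>lborel) = 1"
  proof -
    have "f x = (\<integral>\<^sup>+y. indicator K y * indicator K (y - x) \<partial>lborel)" for x
    proof -
      have "K \<inter> (+) x ` K \<in> sets lborel"
        using K by (auto simp: compact_imp_closed intro!: borel_closed closed_Int compact_imp_closed compact_translation)
      then have "f x = (\<integral>\<^sup>+y. indicator (K \<inter> (+) x ` K) y \<partial>lborel)"
        unfolding f_def by simp
      then show ?thesis by (simp add: indicator_inter_arith tr indicator_def flip: of_bool_conj cong: nn_integral_cong)
    qed
    then have "(\<integral>\<^sup>+x. f x \<partial>lborel) = (\<integral>\<^sup>+x. \<integral>\<^sup>+y. indicator K y * indicator K (y - x) \<partial>lborel \<partial>lborel)"
      by simp
    also have "\<dots> = (\<integral>\<^sup>+y. \<integral>\<^sup>+x. indicator K y * indicator K (y - x) \<partial>lborel \<partial>lborel)"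
      by (rule lborel_pair.Fubini'[symmetric]) measurable
    also have "\<dots> = (\<integral>\<^sup>+y. indicator K y * (\<integral>\<^sup>+x. indicator {x. y - x \<in> K} x \<partial>lborel) \<partial>lborel)"
      by (intro nn_integral_cong) (auto simp: indicator_def)
    also have "\<dots> = (\<integral>\<^sup>+y. indicator K y \<partial>lborel)"
    proof (intro nn_integral_cong)
      fix y
      have "{x. y - x \<in> K} \<in> sets lborel" by simp
      then show "indicator K y * (\<integral>\<^sup>+x. indicator {x. y - x \<in> K} x \<partial>lborel) = (indicator K y :: ennreal)"
        by (simp add: refl)
    qed
    also have "\<dots> = 1" using K1 by simp
    finally show ?thesis .
  qed
  have flow: "ennreal ((1 - \<theta>) ^ d) \<le> f x" if \<theta>: "\<theta> \<in> {0..1}" and x: "x \<in> (*\<^sub>R) \<theta> ` D" for \<theta> x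
  proof -
    obtain a b where ab: "a \<in> K" "b \<in> K" "x = \<theta> *\<^sub>R (a - b)" using x by (auto simp: D_def)
    have "homothet (\<theta> *\<^sub>R a) (1 - \<theta>) K \<subseteq> K \<inter> (+) x ` K"
    proof
      fix z assume "z \<in> homothet (\<theta> *\<^sub>R a) (1 - \<theta>) K"
      then obtain k where k: "k \<in> K" "z = \<theta> *\<^sub>R a + (1 - \<theta>) *\<^sub>R k" by (auto simp: homothet_def)
      have "z \<in> K" unfolding k using K k ab \<theta> by (intro convexD) auto
      moreover have "z - x = \<theta> *\<^sub>R b + (1 - \<theta>) *\<^sub>R k" by (simp add: k ab algebra_simps)
      then have "z - x \<in> K" using convexD[OF K(2) ab(2) k(1), of \<theta> "1 - \<theta>"] \<theta> by simp
      ultimately show "z \<in> K \<inter> (+) x ` K" using tr by blast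
    qed
    then have "emeasure lebesgue (homothet (\<theta> *\<^sub>R a) (1 - \<theta>) K) \<le> emeasure lebesgue (K \<inter> (+) x ` K)"
      using K by (intro emeasure_mono) (auto intro!: lmeasurable_compact fmeasurableD compact_Int compact_translation)
    moreover have "K \<inter> (+) x ` K \<in> sets borel"
      using K by (intro borel_compact compact_Int compact_translation)
    ultimately show ?thesis using emeasure_homothet[of "1 - \<theta>" "\<theta> *\<^sub>R a" K] \<theta> K by (simp add: f_def d_def)
  qed
  \<comment> \<open>\<open>M\<close> collects the pairs with \<open>x \<in> \<theta> D\<close>. As a
    continuous image of a compact set it is compact, hence measurable for Fubini.\<close>
  define M where "M = (\<lambda>(\<theta>::real, z). (\<theta>, \<theta> *\<^sub>R z)) ` ({0..1} \<times> D)"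
  have M: "compact M" unfolding M_def
    using D by (intro compact_continuous_image compact_Times) (auto simp: case_prod_unfold intro!: continuous_intros)
  have Mm[measurable]: "M \<in> sets (borel \<Otimes>\<^sub>M borel)"
    using M by (subst borel_prod) (auto intro: borel_compact)
  have Miff: "(\<theta>, x) \<in> M \<longleftrightarrow> \<theta> \<in> {0..1} \<and> x \<in> (*\<^sub>R) \<theta> ` D" for \<theta> x by (auto simp: M_def)
  \<comment> \<open>Minus the derivative of \<open>(1 - \<theta>) ^ d\<close>, so that its integral
    over \<open>{g..1}\<close> is \<open>(1 - g) ^ d\<close>. In the other order of integration the
    slices \<open>\<theta> D\<close> contribute \<open>\<theta> ^ d\<close>, which leads to the Beta
    integral.\<close>
  define w where "w \<theta> = real d * (1 - \<theta>) ^ (d - 1)" for \<theta> :: real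
  have wm[measurable]: "w \<in> borel_measurable borel" unfolding w_def by measurable
  have inner: "(\<integral>\<^sup>+\<theta>. ennreal (w \<theta>) * indicator M (\<theta>, x) \<partial>lborel) \<le> f x" for x
  proof (cases "\<exists>\<theta>. (\<theta>, x) \<in> M")
    case False
    then show ?thesis by simp
  next
    case True
    let ?T = "{\<theta>. (\<theta>, x) \<in> M}"
    \<comment> \<open>The least \<open>\<theta>\<close> with \<open>x \<in> \<theta> D\<close>,
      attained because \<open>M\<close> is closed.\<close>
    define g where "g = Inf ?T"
    have "closed ((\<lambda>\<theta>. (\<theta>, x)) -` M)"
      using M by (intro closed_vimage compact_imp_closed continuous_intros) auto
    then have "closed ?T" by (simp add: vimage_def)
    moreover have bb: "bdd_below ?T" by (rule bdd_belowI[of _ 0]) (auto simp: Miff)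
    ultimately have g: "(g, x) \<in> M" unfolding g_def using closed_contains_Inf[of ?T] True by auto
    then have g01: "g \<in> {0..1}" by (simp add: Miff)
    have "(\<integral>\<^sup>+\<theta>. ennreal (w \<theta>) * indicator M (\<theta>, x) \<partial>lborel) \<le> (\<integral>\<^sup>+\<theta>. ennreal (w \<theta>) * indicator {g..1} \<theta> \<partial>lborel)"
    proof (intro nn_integral_mono mult_left_mono)
      fix \<theta> :: real
      have "\<theta> \<in> {g..1}" if "(\<theta>, x) \<in> M"
        using cInf_lower[of \<theta> ?T, OF _ bb] that by (auto simp: g_def Miff)
      then show "indicator M (\<theta>, x) \<le> (indicator {g..1} \<theta> :: ennreal)" by (auto simp: indicator_def)
    qed auto
    also have "\<dots> = ennreal ((- ((1 - 1) ^ d)) - (- ((1 - g) ^ d)))"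
    proof (rule nn_integral_has_integral_lebesgue'[OF _ fundamental_theorem_of_calculus])
      show "((\<lambda>\<theta>. - ((1 - \<theta>) ^ d)) has_vector_derivative w \<theta>) (at \<theta> within {g..1})" for \<theta>
        unfolding has_real_derivative_iff_has_vector_derivative[symmetric] w_def
        by (auto intro!: derivative_eq_intros)
    qed (use g01 in \<open>auto simp: w_def\<close>)
    also have "\<dots> = ennreal ((1 - g) ^ d)" using d by (simp add: power_0_left)
    also have "\<dots> \<le> f x" using flow g by (simp add: Miff)
    finally show ?thesis .
  qed
  have "(\<integral>\<^sup>+\<theta>. \<integral>\<^sup>+x. ennreal (w \<theta>) * indicator M (\<theta>, x) \<partial>lborel \<partial>lborel)
      = emeasure lebesgue D * ennreal (1 / real ((2 * d) choose d))"
  proof -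
    have "(\<integral>\<^sup>+x. ennreal (w \<theta>) * indicator M (\<theta>, x) \<partial>lborel)
        = emeasure lebesgue D * (ennreal (w \<theta> * \<theta> ^ d) * indicator {0..1} \<theta>)" for \<theta>
    proof (cases "\<theta> \<in> {0..1}")
      case True
      have eq: "(*\<^sub>R) \<theta> ` D = homothet 0 \<theta> D" by (simp add: homothet_def)
      have "compact ((*\<^sub>R) \<theta> ` D)" using D by (rule compact_scaling)
      then have "(\<integral>\<^sup>+x. ennreal (w \<theta>) * indicator M (\<theta>, x) \<partial>lborel)
          = (\<integral>\<^sup>+x. ennreal (w \<theta>) * indicator ((*\<^sub>R) \<theta> ` D) x \<partial>lborel)"
        using True by (intro nn_integral_cong) (auto simp: indicator_def Miff)
      also have "\<dots> = ennreal (w \<theta>) * emeasure lebesgue (homothet 0 \<theta> D)"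
        using \<open>compact ((*\<^sub>R) \<theta> ` D)\<close> unfolding eq by (subst nn_integral_cmult_indicator) (auto simp: borel_compact)
      also have "\<dots> = emeasure lebesgue D * (ennreal (w \<theta> * \<theta> ^ d))"
        using True by (simp add: emeasure_homothet d_def[symmetric] ennreal_mult'' mult_ac)
      finally show ?thesis using True by simp
    next
      case False
      then show ?thesis by (auto simp: indicator_def Miff intro!: nn_integral_0_iff_AE[THEN iffD2])
    qed
    then have "(\<integral>\<^sup>+\<theta>. \<integral>\<^sup>+x. ennreal (w \<theta>) * indicator M (\<theta>, x) \<partial>lborel \<partial>lborel)
       = (\<integral>\<^sup>+\<theta>. emeasure lebesgue D * (ennreal (w \<theta> * \<theta> ^ d) * indicator {0..1} \<theta>) \<partial>lborel)"
      by simp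
    also have "\<dots> = emeasure lebesgue D * (\<integral>\<^sup>+\<theta>. (ennreal (w \<theta> * \<theta> ^ d) * indicator {0..1} \<theta>) \<partial>lborel)"
      by (rule nn_integral_cmult) measurable
    also have "\<dots> = emeasure lebesgue D * ennreal (1 / real ((2 * d) choose d))"
      using nn_integral_Beta_choose[OF d] by (simp add: w_def)
    finally show ?thesis .
  qed
  also have "(\<integral>\<^sup>+\<theta>. \<integral>\<^sup>+x. ennreal (w \<theta>) * indicator M (\<theta>, x) \<partial>lborel \<partial>lborel)
      = (\<integral>\<^sup>+x. \<integral>\<^sup>+\<theta>. ennreal (w \<theta>) * indicator M (\<theta>, x) \<partial>lborel \<partial>lborel)"
    by (rule lborel_pair.Fubini'[symmetric]) measurable
  finally have "emeasure lebesgue D * ennreal (1 / real ((2 * d) choose d)) = \<dots>" ..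
  also have "\<dots> \<le> (\<integral>\<^sup>+x. f x \<partial>lborel)" by (intro nn_integral_mono inner)
  also have "\<dots> = 1" by (rule intf)
  finally have "emeasure lebesgue D * ennreal (1 / real ((2 * d) choose d)) \<le> 1" .
  moreover have "emeasure lebesgue D = ennreal (measure lebesgue D)"
    using lmeasurable_compact[OF D] by (simp add: emeasure_eq_measure2)
  ultimately have "measure lebesgue D * (1 / real ((2 * d) choose d)) \<le> 1"
    by (simp add: ennreal_mult[symmetric] del: ennreal_1 flip: ennreal_1)
  then have "measure lebesgue D \<le> real ((2 * d) choose d)" by (simp add: field_simps)
  then show ?thesis unfolding D_def d_def .
qed

section \<open>Coverings across scales\<close>

text \<open>The left side is the loss from keeping one residue class of exponents,
  \<open>q ^ d\<close> the loss from rounding, and the first factor on the right the loss from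
  shrinking. Dimension three is computed directly, since the inequality
  \<open>2 * d \<le> 2 ^ (d - 1)\<close> behind the general case starts at four.\<close>

lemma multiscale_budget:
  fixes d :: nat
  assumes d: "d \<ge> 3"
  defines "q \<equiv> real d / (real d + 1)"
  shows "real (d * (d - 1)) \<le> (1 - q ^ (d * (d - 1))) ^ d * q ^ d * (real d ^ 3 * ln (real d))"
proof (cases "d = 3")
  case True
  have "ln (3::real) \<ge> 1" using e_less_272 by (simp add: ln_ge_iff)
  then have ln3: "(1 - (3/4::real)^6) ^ 3 * (3/4)^3 * (27 * 1) \<le> (1 - (3/4::real)^6) ^ 3 * (3/4)^3 * (27 * ln 3)"
    by (intro mult_left_mono mult_nonneg_nonneg zero_le_power) (auto simp: power_divide)
  have "(6::real) \<le> (1 - (3/4::real)^6) ^ 3 * (3/4)^3 * (27 * 1)" by (simp add: power_divide)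
  from order_trans[OF this ln3] show ?thesis using True by (simp add: q_def)
next
  case False
  then have d4: "d \<ge> 4" using d by simp
  have q0: "0 < q" "q < 1" using d by (auto simp: q_def)
  \<comment> \<open>The power \<open>(1 + 1 / d) ^ d\<close> lies between \<open>2\<close> and
    \<open>exp 1\<close>, which places \<open>q ^ d\<close> between \<open>100 / 272\<close> and
    \<open>1 / 2\<close>.\<close>
  have "1 + 1 / real d = inverse q" using d by (simp add: q_def field_simps)
  moreover have "(1 + 1 / real d) ^ d \<le> exp 1"
    using exp_ge_one_plus_x_over_n_power_n[of d 1] d by simp
  ultimately have "inverse q ^ d \<le> 272 / 100" using e_less_272 by simp
  then have qd: "100 / 272 \<le> q ^ d"
    using q0 by (simp add: field_simps power_inverse)
  have "- 1 \<le> 1 / real d" by (rule order_trans[of _ 0]) auto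
  then have "2 \<le> (1 + 1 / real d) ^ d"
    using Bernoulli_inequality[of "1 / real d" d] d by simp
  then have "2 \<le> inverse q ^ d" using \<open>1 + 1 / real d = inverse q\<close> by simp
  then have qd': "q ^ d \<le> 1 / 2" using q0 by (simp add: field_simps power_inverse)
  \<comment> \<open>The power is \<open>(q ^ d) ^ (d - 1)\<close>. Being this small, it lets
    Bernoulli keep the shrinking factor at least \<open>1 / 2\<close>.\<close>
  have eps: "q ^ (d * (d - 1)) \<le> (1/2) ^ (d - 1)"
    unfolding power_mult using qd' q0 by (intro power_mono) auto
  have pow: "real d * 2 \<le> 2 ^ (d - 1)"
  proof -
    have "real (n + 4) * 2 \<le> 2 ^ (n + 3)" for n
    proof (induction n)
      case (Suc n)
      have "real (Suc n + 4) * 2 \<le> 2 * (real (n + 4) * 2)" by simp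
      also have "\<dots> \<le> 2 * 2 ^ (n + 3)" using Suc.IH by (rule mult_left_mono) simp
      finally show ?case by (simp add: power_add)
    qed simp
    from this[of "d - 4"] show ?thesis using d4 by (simp add: of_nat_diff)
  qed
  have "1 / 2 \<le> 1 - real d * q ^ (d * (d - 1))"
  proof -
    have "real d * q ^ (d * (d - 1)) \<le> real d * (1/2) ^ (d - 1)" using eps by (intro mult_left_mono) auto
    also have "\<dots> \<le> 1 / 2" using pow by (simp add: power_one_over field_simps)
    finally show ?thesis by simp
  qed
  also have "\<dots> \<le> (1 - q ^ (d * (d - 1))) ^ d"
    using Bernoulli_inequality[of "- (q ^ (d * (d - 1)))" d] q0 by (simp add: power_le_one)
  finally have half: "1 / 2 \<le> (1 - q ^ (d * (d - 1))) ^ d" .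
  have "ln (real d) \<ge> ln (2 ^ 2)" using d4 by (subst ln_le_cancel_iff) auto
  also have "ln (2 ^ 2 :: real) = 2 * ln 2" by (subst ln_realpow) auto
  finally have ln: "ln (real d) \<ge> 4 / 3" using ln2_ge_two_thirds by linarith
  have "real (d * (d - 1)) \<le> 1/2 * (100/272) * (real d ^ 3 * (4/3))"
  proof -
    \<comment> \<open>The tangent to the square at \<open>4\<close> makes the inequality
      linear.\<close>
    have "0 \<le> (real d - 4) * (real d - 4)" by simp
    then have "real d * real d \<ge> 8 * real d - 16" by (simp add: algebra_simps)
    then have "real d - 1 \<le> 1/2 * (100/272) * (real d * real d * (4/3))" using d4 by simp
    then have "real d * (real d - 1) \<le> real d * (1/2 * (100/272) * (real d * real d * (4/3)))"
      by (intro mult_left_mono) auto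
    then show ?thesis using d by (simp add: of_nat_diff power3_eq_cube algebra_simps)
  qed
  also have "\<dots> \<le> (1 - q ^ (d * (d - 1))) ^ d * q ^ d * (real d ^ 3 * ln (real d))"
    using half qd ln d by (intro mult_mono) auto
  finally show ?thesis .
qed

text \<open>The class sums add up to the whole sum, so one of them is at least the average.\<close>

lemma exists_residue_class_share:
  fixes g :: "'i \<Rightarrow> real"
  assumes "finite J" "m > 0"
  shows "\<exists>c. (\<Sum>i\<in>J. g i) \<le> real m * (\<Sum>i\<in>{i\<in>J. k i mod m = c}. g i)"
proof (rule ccontr)
  assume "\<not> ?thesis"
  then have a: "real m * (\<Sum>i\<in>{i\<in>J. k i mod m = c}. g i) < (\<Sum>i\<in>J. g i)" for c by (simp add: not_le)
  have "real m * (\<Sum>i\<in>J. g i) = (\<Sum>c<m. real m * (\<Sum>i\<in>{i\<in>J. k i mod m = c}. g i))"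
    using sum.group[of J "{..<m}" "\<lambda>i. k i mod m" g] assms by (simp add: sum_distrib_left[symmetric] image_subset_iff)
  also have "\<dots> < (\<Sum>c<m. (\<Sum>i\<in>J. g i))" using a assms by (intro sum_strict_mono) auto
  finally show False by simp
qed

theorem multiscale_cover:
  fixes K :: "'a::euclidean_space set"
  assumes K: "compact K" "convex K" "0 \<in> K" "emeasure lebesgue K = 1"
    and econ: "economical \<theta> K" and \<theta>: "\<theta> > 0" and d: "DIM('a) \<ge> 3"
    and W: "open W" "bounded W" "\<And>x y. x \<in> K \<Longrightarrow> y \<in> K \<Longrightarrow> x - y \<in> W"
    and J: "finite J" "\<And>i. i \<in> J \<Longrightarrow> l i > 0"
    and large: "real DIM('a) ^ 3 * ln (real DIM('a)) * \<theta> * measure lebesgue W < (\<Sum>i\<in>J. l i ^ DIM('a))"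
  shows "covers_with J l K K"
proof (cases "\<exists>i\<in>J. l i \<ge> 1")
  case True
  then obtain i where i: "i \<in> J" "l i \<ge> 1" by blast
  then show ?thesis using K by (intro covers_with_single[of K i J l]) auto
next
  case False
  define d where "d = DIM('a)"
  have d3: "d \<ge> 3" using d by (simp add: d_def)
  define q where "q = real d / (real d + 1)"
  \<comment> \<open>Keeping one class modulo \<open>m\<close> costs a factor \<open>m\<close>, while
    distinct ratios within it differ at least by the factor \<open>q ^ m\<close>, which is small
    because \<open>q ^ d \<le> 1 / 2\<close>.\<close>
  define m where "m = d * (d - 1)"
  have q: "0 < q" "q < 1" and m: "m > 0" using d3 by (auto simp: q_def m_def)
  have "\<exists>k. q ^ Suc k \<le> l i \<and> l i < q ^ k" if "i \<in> J" for i
    using exists_power_bracket[OF q J(2)[OF that]] False that by (meson not_le)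
  then obtain k where k: "\<forall>i\<in>J. q ^ Suc (k i) \<le> l i \<and> l i < q ^ k i" by metis
  obtain c where c: "(\<Sum>i\<in>J. l i ^ d) \<le> real m * (\<Sum>i\<in>{i\<in>J. k i mod m = c}. l i ^ d)"
    using exists_residue_class_share[OF J(1) m, of "\<lambda>i. l i ^ d" k] by blast
  define C where "C = {i\<in>J. k i mod m = c}"
  define \<epsilon> where "\<epsilon> = q ^ m"
  have \<epsilon>: "0 < \<epsilon>" "\<epsilon> < 1" using q m by (auto simp: \<epsilon>_def power_less_one_iff)
  define r where "r = (\<lambda>i. q ^ Suc (k i))"
  have rpos: "r i > 0" for i using q by (simp add: r_def)
  \<comment> \<open>As \<open>r i \<le> 1\<close> and \<open>K\<close> contains the origin,
    \<open>r i K \<subseteq> K\<close>, so a window for \<open>K - K\<close> serves all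
    ratios.\<close>
  have scaled: "x - r i *\<^sub>R y \<in> W" if xy: "i \<in> C" "x \<in> K" "y \<in> K" for i x y
  proof -
    have "r i \<le> 1" using q unfolding r_def by (intro power_le_one) auto
    then obtain z where "z \<in> K" "r i *\<^sub>R y = 1 *\<^sub>R z"
      using convex_sum_scaled[OF K(2,3) xy(3) K(3), of "r i" 0 1] rpos[of i] by auto
    then show ?thesis using W(3)[OF xy(2)] by simp
  qed
  have gap: "r i \<le> \<epsilon> * r j" if ij: "i \<in> C" "j \<in> C" "r i < r j" for i j
  proof -
    have "k j < k i" using ij(3) q unfolding r_def by (simp add: power_strict_decreasing_iff)
    moreover have "k j mod m = k i mod m" using ij by (simp add: C_def)
    ultimately have "m \<le> k i - k j" by (metis dvd_imp_le less_imp_le mod_eq_dvd_iff_nat zero_less_diff)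
    then have "Suc (k j) + m \<le> Suc (k i)" using \<open>k j < k i\<close> by simp
    then have "q ^ Suc (k i) \<le> q ^ (Suc (k j) + m)" using q by (intro power_decreasing) auto
    then show ?thesis by (simp add: r_def \<epsilon>_def power_add mult_ac)
  qed
  have "\<theta> * measure lebesgue W < (\<Sum>i\<in>C. ((1 - \<epsilon>) * r i) ^ d)"
  proof -
    let ?D = "real d ^ 3 * ln (real d)" and ?c = "(1 - \<epsilon>) ^ d * q ^ d"
    have c0: "?c > 0" using q \<epsilon> by simp
    have "real m * (\<theta> * measure lebesgue W) \<le> ?c * ?D * (\<theta> * measure lebesgue W)"
      using multiscale_budget[OF d3] \<theta> unfolding m_def \<epsilon>_def q_def
      by (intro mult_right_mono) auto
    also have "\<dots> = ?c * (?D * \<theta> * measure lebesgue W)" by (simp add: mult_ac)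
    also have "\<dots> < ?c * (\<Sum>i\<in>J. l i ^ d)" using large c0 unfolding d_def by (intro mult_strict_left_mono)
    also have "\<dots> \<le> ?c * (real m * (\<Sum>i\<in>C. l i ^ d))" using c c0 unfolding C_def by (intro mult_left_mono) auto
    also have "\<dots> = real m * (\<Sum>i\<in>C. ?c * l i ^ d)" by (simp add: sum_distrib_left mult_ac)
    also have "\<dots> \<le> real m * (\<Sum>i\<in>C. ((1 - \<epsilon>) * r i) ^ d)"
    proof (intro mult_left_mono sum_mono)
      fix i assume "i \<in> C"
      then have "i \<in> J" by (simp add: C_def)
      then have "(q * l i) ^ d \<le> r i ^ d"
        using k J(2) q unfolding r_def by (intro power_mono) (auto simp: less_imp_le)
      then show "?c * l i ^ d \<le> ((1 - \<epsilon>) * r i) ^ d"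
        using \<epsilon> by (simp add: power_mult_distrib mult.assoc)
    qed auto
    finally show ?thesis using m by simp
  qed
  then have "covers_with C r K K"
    using greedy_multiscale_cover[OF K econ \<theta> \<epsilon>, of C r W K] J(1) rpos gap scaled W(1,2)
    unfolding d_def by (simp add: C_def)
  moreover have "K \<noteq> {}" using K(3) by blast
  moreover have "0 < r i \<and> r i \<le> l i" if "i \<in> C" for i using k rpos that by (simp add: r_def C_def)
  ultimately have "covers_with C l K K" using covers_with_enlarge[of C r K K l] K(2) by simp
  then show ?thesis by (rule covers_with_mono) (auto simp: C_def)
qed

section \<open>From total volume to finite covering families\<close>

lemma covers_with_translate:
  assumes "covers_with J l ((+) p ` K) ((+) p ` K)"
  shows "covers_with J l K K"
proof -
  obtain t where t: "(+) p ` K \<subseteq> (\<Union>i\<in>J. homothet (t i + l i *\<^sub>R p) (l i) K)"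
    using assms unfolding covers_with_def homothet_translate by blast
  have "K = homothet (- p) 1 ((+) p ` K)" by (simp add: homothet_def image_image)
  also have "\<dots> \<subseteq> (\<Union>i\<in>J. homothet (- p + (t i + l i *\<^sub>R p)) (l i) K)"
    using homothet_mono[OF t, of "- p" 1] by (simp add: homothet_UN homothet_homothet)
  finally show ?thesis unfolding covers_with_def by (intro exI[of _ "\<lambda>i. - p + (t i + l i *\<^sub>R p)"])
qed

text \<open>Outer regularity supplies \<open>T\<close>, and intersecting with a ball around
  \<open>S\<close> makes it bounded. Applied to \<open>K - K\<close> this gives the initial
  window.\<close>

lemma compact_open_neighbourhood:
  fixes S :: "'a::euclidean_space set"
  assumes "compact S" "\<delta> > 0"
  obtains W where "open W" "bounded W" "S \<subseteq> W" "measure lebesgue W < measure lebesgue S + \<delta>"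
proof -
  have S: "S \<in> lmeasurable" using assms by (rule_tac lmeasurable_compact)
  obtain T where T: "open T" "S \<subseteq> T" "T - S \<in> lmeasurable" "emeasure lebesgue (T - S) < ennreal \<delta>"
    using sets_lebesgue_outer_open[of S \<delta>] S assms by (auto dest: fmeasurableD)
  obtain R where R: "S \<subseteq> ball 0 R" using bounded_subset_ballD[OF compact_imp_bounded[OF assms(1)], of 0] by blast
  have lt: "measure lebesgue (T - S) < \<delta>"
    using T(3,4) assms by (simp add: emeasure_eq_measure2 ennreal_less_iff)
  have eq: "T \<inter> ball 0 R = S \<union> ((T - S) \<inter> ball 0 R)" using T(2) R by blast
  have "measure lebesgue (T \<inter> ball 0 R) \<le> measure lebesgue S + measure lebesgue ((T - S) \<inter> ball 0 R)"
    unfolding eq using S T(3) by (intro measure_Un_le) (auto dest: fmeasurableD)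
  also have "measure lebesgue ((T - S) \<inter> ball 0 R) \<le> measure lebesgue (T - S)"
    using T(3) by (intro measure_mono_fmeasurable) (auto dest: fmeasurableD)
  finally have "measure lebesgue (T \<inter> ball 0 R) < measure lebesgue S + \<delta>" using lt by simp
  then show ?thesis using that[of "T \<inter> ball 0 R"] T R by (auto intro: bounded_Int)
qed

text \<open>Half of \<open>x - y\<close> is the midpoint of \<open>x\<close> and \<open>- y\<close>,
  so the difference body lies in \<open>2 K\<close>.\<close>

lemma measure_differences_symmetric:
  fixes K :: "'a::euclidean_space set"
  assumes K: "compact K" "convex K" "emeasure lebesgue K = 1" and sym: "uminus ` K = K"
  shows "measure lebesgue {x - y |x y. x \<in> K \<and> y \<in> K} \<le> 2 ^ DIM('a)"
proof -
  have K1: "measure lebesgue K = 1" using K(3) by (simp add: measure_def)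
  have "{x - y |x y. x \<in> K \<and> y \<in> K} \<subseteq> homothet 0 2 K"
  proof clarsimp
    fix x y assume "x \<in> K" "y \<in> K"
    moreover have "- y \<in> K" using \<open>y \<in> K\<close> sym by blast
    ultimately have "(1/2) *\<^sub>R x + (1/2) *\<^sub>R (- y) \<in> K" using K(2) by (intro convexD) auto
    moreover have "x - y = 0 + 2 *\<^sub>R ((1/2) *\<^sub>R x + (1/2) *\<^sub>R (- y))" by (simp add: scaleR_diff_right)
    ultimately show "x - y \<in> homothet 0 2 K" unfolding homothet_def by blast
  qed
  moreover have "compact {x - y |x y. x \<in> K \<and> y \<in> K}" using K by (intro compact_differences)
  moreover have "compact (homothet 0 2 K)" unfolding homothet_def using K by (intro compact_affinity)
  ultimately have "measure lebesgue {x - y |x y. x \<in> K \<and> y \<in> K} \<le> measure lebesgue (homothet 0 2 K)"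
    by (intro measure_mono_fmeasurable) (auto dest: lmeasurable_compact fmeasurableD)
  then show ?thesis by (simp add: measure_homothet K1)
qed

text \<open>The infinite sum is the supremum of its finite partial sums, so one of these already
  exceeds \<open>B\<close>. This reduces families of any cardinality to finite ones.\<close>

lemma finite_subfamily_exceeding:
  fixes g :: "'i \<Rightarrow> real"
  assumes "\<And>i. i \<in> I \<Longrightarrow> g i \<ge> 0" "B \<ge> 0" "ennreal B < (\<Sum>\<^sub>\<infinity>i\<in>I. ennreal (g i))"
  obtains J where "finite J" "J \<subseteq> I" "B < (\<Sum>i\<in>J. g i)"
proof -
  have "(\<Sum>\<^sub>\<infinity>i\<in>I. ennreal (g i)) = (SUP J\<in>{J. finite J \<and> J \<subseteq> I}. \<Sum>i\<in>J. ennreal (g i))"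
    by (rule nonneg_infsum_complete) simp
  then obtain J where J: "finite J" "J \<subseteq> I" "ennreal B < (\<Sum>i\<in>J. ennreal (g i))"
    using assms(3) by (auto simp: less_SUP_iff)
  moreover have "(\<Sum>i\<in>J. ennreal (g i)) = ennreal (\<Sum>i\<in>J. g i)"
    using J(2) assms(1) by (intro sum_ennreal) auto
  ultimately show ?thesis using that[of J] assms(2) by (simp add: ennreal_less_iff)
qed

lemma permits_translative_covering_homothets:
  fixes K A :: "'a::euclidean_space set"
  assumes cov: "covers_with J l K A" and J: "J \<subseteq> I" and F: "\<And>i. i \<in> I \<Longrightarrow> F i = homothet (c i) (l i) K"
  shows "permits_translative_covering I F A"
proof -
  obtain t where t: "A \<subseteq> (\<Union>i\<in>I. homothet (t i) (l i) K)"
    using covers_with_mono[OF cov J order_refl] unfolding covers_with_def by blast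
  have "(\<lambda>y. (t i - c i) + y) ` F i = homothet (t i) (l i) K" if "i \<in> I" for i
    unfolding F[OF that] homothet_def by (simp add: image_image algebra_simps)
  then have "(\<Union>i\<in>I. homothet (t i) (l i) K) = (\<Union>i\<in>I. (\<lambda>y. (t i - c i) + y) ` F i)" by simp
  then show ?thesis using t unfolding permits_translative_covering_def
    by (intro exI[of _ "\<lambda>i. t i - c i"]) simp
qed

text \<open>The strict inequality for \<open>S\<close> leaves room for a density bound above
  \<open>\<tau>\<close>, a window larger than \<open>K - K\<close> and the passage to a finite
  subfamily.\<close>

lemma multiscale_cover_of_total_volume:
  fixes K :: "'a::euclidean_space set"
  assumes K: "convex_body K" "emeasure lebesgue K = 1" and d: "DIM('a) \<ge> 3"
    and \<tau>: "translative_covering_density K = ennreal \<tau>" "\<tau> \<ge> 0"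
    and V: "measure lebesgue {x - y |x y. x \<in> K \<and> y \<in> K} \<le> V"
    and S: "real DIM('a) ^ 3 * ln (real DIM('a)) * \<tau> * V < S"
    and l: "\<And>i. i \<in> I \<Longrightarrow> l i > 0"
    and total: "ennreal S \<le> (\<Sum>\<^sub>\<infinity>i\<in>I. ennreal (l i ^ DIM('a)))"
  shows "\<exists>J\<subseteq>I. covers_with J l K K"
proof -
  define D where "D = real DIM('a) ^ 3 * ln (real DIM('a))"
  have cK: "compact K" "convex K" "interior K \<noteq> {}" using K by (auto simp: convex_body_def)
  have D0: "D \<ge> 0" using d by (simp add: D_def)
  have V0: "V \<ge> 0" using V measure_nonneg order_trans by blast
  have "((\<lambda>\<delta>. D * (\<tau> + \<delta>) * (V + \<delta>)) \<longlongrightarrow> D * (\<tau> + 0) * (V + 0)) (at_right 0)"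
    by (intro tendsto_intros)
  then have "\<forall>\<^sub>F \<delta> in at_right 0. D * (\<tau> + \<delta>) * (V + \<delta>) < S"
    using S unfolding D_def by (intro order_tendstoD(2)[where y = "D * (\<tau> + 0) * (V + 0)"]) (auto simp: D_def)
  then have "\<forall>\<^sub>F \<delta> in at_right 0. D * (\<tau> + \<delta>) * (V + \<delta>) < S \<and> \<delta> > 0"
    using eventually_at_right_less by (rule eventually_conj)
  then obtain \<delta> where \<delta>: "D * (\<tau> + \<delta>) * (V + \<delta>) < S" "\<delta> > 0"
    using eventually_happens trivial_limit_at_right_real by blast
  define \<theta> where "\<theta> = \<tau> + \<delta>"
  have \<theta>: "\<theta> > 0" "translative_covering_density K < ennreal \<theta>"
    using \<tau> \<delta>(2) by (auto simp: \<theta>_def ennreal_less_iff)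
  obtain W where W: "open W" "bounded W" "{x - y |x y. x \<in> K \<and> y \<in> K} \<subseteq> W" "measure lebesgue W < V + \<delta>"
    using compact_open_neighbourhood[OF compact_differences[OF cK(1) cK(1)] \<delta>(2)] V
    by (metis (no_types, lifting) add_le_cancel_right less_le_trans)
  have "D * \<theta> * (V + \<delta>) \<ge> 0" using D0 V0 \<theta>(1) \<delta>(2) by simp
  then have "ennreal (D * \<theta> * (V + \<delta>)) < ennreal S" using \<delta>(1) by (simp add: \<theta>_def ennreal_less_iff)
  then have "ennreal (D * \<theta> * (V + \<delta>)) < (\<Sum>\<^sub>\<infinity>i\<in>I. ennreal (l i ^ DIM('a)))" using total by (rule less_le_trans)
  then obtain J where J: "finite J" "J \<subseteq> I" "D * \<theta> * (V + \<delta>) < (\<Sum>i\<in>J. l i ^ DIM('a))"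
    using finite_subfamily_exceeding[of I "\<lambda>i. l i ^ DIM('a)" "D * \<theta> * (V + \<delta>)"] l \<open>D * \<theta> * (V + \<delta>) \<ge> 0\<close>
    by (auto simp: less_imp_le)
  have "D * \<theta> * measure lebesgue W \<le> D * \<theta> * (V + \<delta>)"
    using W(4) D0 \<theta>(1) by (intro mult_left_mono) auto
  then have large: "D * \<theta> * measure lebesgue W < (\<Sum>i\<in>J. l i ^ DIM('a))" using J(3) by simp
  \<comment> \<open>Moving \<open>p\<close> to the origin meets the requirement
    \<open>0 \<in> K\<close> of \<open>multiscale_cover\<close>; differences of points are
    unchanged.\<close>
  obtain p where p: "p \<in> K" using cK(3) interior_subset by blast
  let ?K = "(+) (- p) ` K"
  have "covers_with J l ?K ?K"
  proof (rule multiscale_cover[OF _ _ _ _ _ \<theta>(1) d W(1,2)])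
    show "compact ?K" using cK(1) by (rule compact_translation)
    show "convex ?K" using cK(2) by (rule convex_translation)
    show "0 \<in> ?K" using p by (intro image_eqI[of _ _ p]) auto
    show "emeasure lebesgue ?K = 1" using emeasure_homothet[of 1 "- p" K] K(2) by (simp add: homothet_def)
    show "economical \<theta> ?K" using economical_if_density_less[OF cK(1) K(2) \<theta>(2)] by (rule economical_translate)
    show "x - y \<in> W" if xy: "x \<in> ?K" "y \<in> ?K" for x y
    proof -
      obtain a b where ab: "a \<in> K" "b \<in> K" "x = - p + a" "y = - p + b" using xy by blast
      then have "x - y = a - b" by simp
      then show ?thesis using W(3) ab by blast
    qed
    show "finite J" "\<And>i. i \<in> J \<Longrightarrow> l i > 0" using J l by auto
    show "real DIM('a) ^ 3 * ln (real DIM('a)) * \<theta> * measure lebesgue W < (\<Sum>i\<in>J. l i ^ DIM('a))"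
      using large by (simp add: D_def)
  qed
  then have "covers_with J l K K" by (rule covers_with_translate)
  then show ?thesis using J(2) by blast
qed

lemma sandwich_cover_of_total_volume:
  fixes K :: "'a::euclidean_space set"
  assumes K: "convex K" and inner: "homothet p 1 (parallelotope v 1) \<subseteq> K"
    and outer: "K \<subseteq> homothet q 1 (parallelotope v (real N))" and N: "N > 0"
    and l: "\<And>i. i \<in> I \<Longrightarrow> l i > 0"
    and total: "ennreal (real ((2 * N) ^ DIM('a))) < (\<Sum>\<^sub>\<infinity>i\<in>I. ennreal (l i ^ DIM('a)))"
  shows "\<exists>J\<subseteq>I. covers_with J l K K"
proof -
  obtain J where J: "finite J" "J \<subseteq> I" "real ((2 * N) ^ DIM('a)) < (\<Sum>i\<in>J. l i ^ DIM('a))"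
    using finite_subfamily_exceeding[of I "\<lambda>i. l i ^ DIM('a)" "real ((2 * N) ^ DIM('a))"] l total
    by (auto simp: less_imp_le)
  then have "covers_with J l K K"
    using l by (intro parallelotope_sandwich_cover[OF K inner outer N J(1)]) auto
  then show ?thesis using J(2) by blast
qed

section \<open>Case distinction by dimension and finiteness of the density\<close>

theorem theorem1p2:
  fixes K :: "'a::euclidean_space set"
    and I :: "'i set"
    and F :: "'i \<Rightarrow> 'a set"
  assumes "convex_body K"
    and "emeasure lebesgue K = 1"
    and "\<forall>i\<in>I. positive_homothet K (F i)"
    and "(uminus ` K = K \<and>
           (\<Sum>\<^sub>\<infinity> i\<in>I. emeasure lebesgue (F i)) \<ge>
             (ennreal (real DIM('a) ^ 3 * ln (real DIM('a))) * translative_covering_density K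
               + ennreal (exp 1)) * ennreal (2 ^ DIM('a)))
         \<or> (\<Sum>\<^sub>\<infinity> i\<in>I. emeasure lebesgue (F i)) \<ge>
             ennreal (real DIM('a) ^ 3 * ln (real DIM('a))) * translative_covering_density K
               * ennreal (real ((2 * DIM('a)) choose DIM('a)))
             + ennreal (exp 1 * 4 ^ DIM('a))"
  shows "permits_translative_covering I F K"
proof -
  have K: "compact K" "convex K" using assms(1) by (auto simp: convex_body_def)
  define d where "d = DIM('a)"
  define D where "D = real d ^ 3 * ln (real d)"
  define C where "C = real ((2 * d) choose d)"
  define T where "T = (\<Sum>\<^sub>\<infinity> i\<in>I. emeasure lebesgue (F i))"
  have d: "d > 0" by (simp add: d_def)
  have D0: "D \<ge> 0" using d by (simp add: D_def)
  have C0: "C \<ge> 1" unfolding C_def using binomial_eq_0_iff[of "2 * d" d] by (simp add: Suc_le_eq)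
  have "\<forall>i\<in>I. \<exists>l c. l > 0 \<and> F i = homothet c l K"
    using assms(3) by (auto simp: positive_homothet_def homothet_def image_image)
  then obtain l c where lc: "\<And>i. i \<in> I \<Longrightarrow> l i > 0" "\<And>i. i \<in> I \<Longrightarrow> F i = homothet (c i) (l i) K" by metis
  have T: "T = (\<Sum>\<^sub>\<infinity> i\<in>I. ennreal (l i ^ DIM('a)))"
    unfolding T_def using lc assms(2) by (intro infsum_cong) (auto simp: emeasure_homothet less_imp_le)
  have hyp: "(uminus ` K = K \<and> T \<ge> (ennreal D * translative_covering_density K + ennreal (exp 1)) * ennreal (2 ^ d))
      \<or> T \<ge> ennreal D * translative_covering_density K * ennreal C + ennreal (exp 1 * 4 ^ d)"
    using assms(4) unfolding T_def D_def C_def d_def by simp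
  \<comment> \<open>Obtained from \<open>exp (1/2) \<ge> 3/2\<close>; this accuracy suffices in
    dimensions one and two.\<close>
  have e: "exp 1 \<ge> (9/4 :: real)"
  proof -
    have "(3/2)\<^sup>2 \<le> (exp (1/2 :: real))\<^sup>2" using exp_ge_add_one_self[of "1/2"] by (intro power_mono) auto
    then show ?thesis by (simp add: power2_eq_square flip: exp_add)
  qed
  have "\<exists>J\<subseteq>I. covers_with J l K K"
  proof (cases "d = 1")
    case True
    \<comment> \<open>As \<open>ln 1 = 0\<close>, the density term vanishes, in
      \<open>ennreal\<close> even for infinite density. The exponential term alone exceeds
      \<open>2 * N\<close> with \<open>N = 1\<close>.\<close>
    then have "D = 0" by (simp add: D_def)
    have "ennreal 2 < ennreal (exp 1 * 2)" "ennreal 2 < ennreal (exp 1 * 4)" using e by (simp_all add: ennreal_less_iff)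
    then have "ennreal 2 < T" using hyp True \<open>D = 0\<close> by (auto simp: ennreal_mult dest: less_le_trans)
    then have "ennreal (real ((2 * 1) ^ DIM('a))) < T" using True by (simp add: d_def)
    moreover obtain p q v where "homothet p 1 (parallelotope v 1) \<subseteq> K" "K \<subseteq> homothet q 1 (parallelotope v (real 1))"
      by (rule linear_convex_body_sandwich[OF assms(1) True[unfolded d_def]])
    ultimately show ?thesis unfolding T
      by (intro sandwich_cover_of_total_volume[OF K(2), of p v q 1]) (auto simp: lc)
  next
    case False
    then have d2: "d \<ge> 2" using d by simp
    then have Dpos: "D > 0" by (simp add: D_def)
    show ?thesis
    proof (cases "translative_covering_density K = \<infinity>")
      case True
      \<comment> \<open>\<open>D\<close> is positive here, so the total volume is infinite and a
        sandwich with any \<open>N\<close> will do.\<close>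
      then have "T = \<infinity>"
        using hyp Dpos C0 by (auto simp: ennreal_mult_top ennreal_top_mult top_unique)
      obtain p q v N where "N > 0" "homothet p 1 (parallelotope v 1) \<subseteq> K" "K \<subseteq> homothet q 1 (parallelotope v (real N))"
        by (rule convex_body_sandwich[OF assms(1)])
      moreover have "ennreal (real ((2 * N) ^ DIM('a))) < T" using \<open>T = \<infinity>\<close> by simp
      ultimately show ?thesis unfolding T
        by (intro sandwich_cover_of_total_volume[OF K(2), of p v q N]) (auto simp: lc)
    next
      case False
      then obtain \<tau> where \<tau>: "translative_covering_density K = ennreal \<tau>" "\<tau> \<ge> 0"
        by (cases "translative_covering_density K") auto
      have \<tau>1: "\<tau> \<ge> 1" using one_le_density[OF K(1) assms(2)] \<tau> by simp
      have hyp': "(uminus ` K = K \<and> ennreal ((D * \<tau> + exp 1) * 2 ^ d) \<le> T) \<or> ennreal (D * \<tau> * C + exp 1 * 4 ^ d) \<le> T"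
        using hyp D0 C0 \<tau>(2) unfolding \<tau>(1) by (simp add: ennreal_mult ennreal_plus)
      show ?thesis
      proof (cases "d = 2")
        case True
        \<comment> \<open>Here \<open>D = 8 * ln 2\<close> with \<open>ln 2 \<ge> 2/3\<close>, and
          the density is at least one.\<close>
        have ln2: "D * \<tau> \<ge> 16/3"
        proof -
          have "16/3 \<le> D" using ln2_ge_two_thirds True by (simp add: D_def)
          then show ?thesis using \<tau>1 mult_mono[of "16/3" D 1 \<tau>] by simp
        qed
        from hyp' show ?thesis
        proof
          assume a: "uminus ` K = K \<and> ennreal ((D * \<tau> + exp 1) * 2 ^ d) \<le> T"
          obtain p q v where "homothet p 1 (parallelotope v 1) \<subseteq> K" "K \<subseteq> homothet q 1 (parallelotope v (real 2))"
            by (rule planar_symmetric_convex_body_sandwich[OF assms(1) conjunct1[OF a] True[unfolded d_def]])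
          \<comment> \<open>The numbers are \<open>16 < (16/3 + 9/4) * 4\<close>.\<close>
          moreover have "real ((2 * 2) ^ DIM('a)) < (D * \<tau> + exp 1) * 2 ^ d"
            using ln2 e True by (simp add: d_def)
          then have "ennreal (real ((2 * 2) ^ DIM('a))) < ennreal ((D * \<tau> + exp 1) * 2 ^ d)"
            unfolding ennreal_less_iff[OF of_nat_0_le_iff] .
          then have "ennreal (real ((2 * 2) ^ DIM('a))) < T" using a by (auto dest: less_le_trans)
          ultimately show ?thesis unfolding T
            by (intro sandwich_cover_of_total_volume[OF K(2), of p v q 2]) (auto simp: lc)
        next
          assume a: "ennreal (D * \<tau> * C + exp 1 * 4 ^ d) \<le> T"
          obtain p q v where "homothet p 1 (parallelotope v 1) \<subseteq> K" "K \<subseteq> homothet q 1 (parallelotope v (real 4))"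
            by (rule planar_convex_body_sandwich[OF assms(1) True[unfolded d_def]])
          moreover have "C = 6" using True by (simp add: C_def eval_nat_numeral)
          \<comment> \<open>The bounds just suffice:
            \<open>64 < 16/3 * 6 + 9/4 * 16 = 68\<close>.\<close>
          then have "real ((2 * 4) ^ DIM('a)) < D * \<tau> * C + exp 1 * 4 ^ d"
            using ln2 e True by (simp add: d_def)
          then have "ennreal (real ((2 * 4) ^ DIM('a))) < ennreal (D * \<tau> * C + exp 1 * 4 ^ d)"
            unfolding ennreal_less_iff[OF of_nat_0_le_iff] .
          then have "ennreal (real ((2 * 4) ^ DIM('a))) < T" using a by (auto dest: less_le_trans)
          ultimately show ?thesis unfolding T
            by (intro sandwich_cover_of_total_volume[OF K(2), of p v q 4]) (auto simp: lc)
        qed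
      next
        case False
        then have d3: "DIM('a) \<ge> 3" using d2 by (simp add: d_def)
        \<comment> \<open>From dimension three on, the exponential term only makes the inequality
          between \<open>D * \<tau> * V\<close> and \<open>S\<close> strict, with \<open>V\<close>
          equal to \<open>2 ^ d\<close> or \<open>C\<close>.\<close>
        note cover = multiscale_cover_of_total_volume[OF assms(1,2) d3 \<tau> _ _ lc(1), folded d_def, folded D_def]
        from hyp' show ?thesis
        proof
          assume a: "uminus ` K = K \<and> ennreal ((D * \<tau> + exp 1) * 2 ^ d) \<le> T"
          then show ?thesis
            using measure_differences_symmetric[OF K assms(2)]
            by (intro cover[of "2 ^ d" "(D * \<tau> + exp 1) * 2 ^ d"]) (auto simp: d_def T algebra_simps)
        next
          assume a: "ennreal (D * \<tau> * C + exp 1 * 4 ^ d) \<le> T"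
          then show ?thesis
            using rogers_shephard[OF K assms(2)]
            by (intro cover[of C "D * \<tau> * C + exp 1 * 4 ^ d"]) (auto simp: d_def C_def T)
        qed
      qed
    qed
  qed
  then obtain J where J: "J \<subseteq> I" "covers_with J l K K" by blast
  show ?thesis by (rule permits_translative_covering_homothets[OF J(2,1) lc(2)])
qed

end
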